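(* Let $(\Omega,\Sigma,\mu)$ be an atomless probability space, let $T:\Omega\to\Omega$ be an invertible measure-preserving transformation, and let $(a_k)_{k\in\mathbb{Z}}$ be a sequence of positive real numbers with $\sum_{k\in\mathbb{Z}}a_k=1$ and $\sum_{k\in\mathbb{Z}}\sqrt{a_k}<\infty$. Let $X=(L_1(\mu),|||\cdot|||)$, where $$|||f|||=\int_\Omega\Big(\sum_{k\in\mathbb{Z}}a_k|f(T^k\omega)|^2\Big)^{1/2}d\mu(\omega).$$ Then the bidual $X^{**}$ fails the Daugavet property.
   Context: $L_1(\mu)$ is over $\mathbb{K}=\mathbb{R}$ or $\mathbb{C}$. An invertible measure-preserving transformation is a bijection $T:\Omega\to\Omega$ such that $T$ and $T^{-1}$ are measurable and $\mu(T^{-1}(A))=\mu(A)$ for every $A\in\Sigma$. The functional $|||\cdot|||$ is an equivalent norm on $L_1(\mu)$, with $\|f\|_1\le|||f|||\le(\sum_{k}\sqrt{a_k})\|f\|_1$. The bidual $X^{**}$ carries its usual bidual norm. A Banach space $Y$ has the Daugavet property if $\|I+R\|=1+\|R\|$ for every rank-one bounded linear operator $R:Y\to Y$, where $I$ is the identity of $Y$. *)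

theory Defs
  imports "HOL-Probability.Probability"
begin

text \<open>
  Normed spaces over the scalar field \<open>'k\<close>, given by an explicit carrier: \<open>L\<^sub>1(\<mu>)\<close> depends on the
  measure \<open>\<mu>\<close>, hence cannot be a type. The library has complex scalars for neither its normed
  vector space classes nor its bounded linear maps.
\<close>

record ('k, 'v) nspace =
  vset :: "'v set"
  vadd :: "'v \<Rightarrow> 'v \<Rightarrow> 'v"
  vzero :: 'v
  vscale :: "'k \<Rightarrow> 'v \<Rightarrow> 'v"
  vnorm :: "'v \<Rightarrow> real"

definition bounded_linear_op ::
    "('k, 'v) nspace \<Rightarrow> ('k, 'w) nspace \<Rightarrow> ('v \<Rightarrow> 'w) \<Rightarrow> bool" where
  "bounded_linear_op X Y R \<longleftrightarrow>
     (\<forall>x\<in>vset X. R x \<in> vset Y) \<and>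
     (\<forall>x\<in>vset X. \<forall>y\<in>vset X. R (vadd X x y) = vadd Y (R x) (R y)) \<and>
     (\<forall>c. \<forall>x\<in>vset X. R (vscale X c x) = vscale Y c (R x)) \<and>
     (\<exists>C. \<forall>x\<in>vset X. vnorm Y (R x) \<le> C * vnorm X x)"

definition op_norm :: "('k, 'v) nspace \<Rightarrow> ('k, 'w) nspace \<Rightarrow> ('v \<Rightarrow> 'w) \<Rightarrow> real" where
  "op_norm X Y R = (SUP x\<in>{x \<in> vset X. vnorm X x \<le> 1}. vnorm Y (R x))"

definition scalars :: "('k::real_normed_field, 'k) nspace" where
  "scalars = \<lparr>vset = UNIV, vadd = (+), vzero = 0, vscale = (*), vnorm = norm\<rparr>"

text \<open>
  Functionals are extended by \<open>0\<close> outside the carrier, so that distinct elements of the dual are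
  distinct functionals on the carrier.
\<close>

definition dual :: "('k::real_normed_field, 'v) nspace \<Rightarrow> ('k, 'v \<Rightarrow> 'k) nspace" where
  "dual X =
     \<lparr>vset = {\<phi>. bounded_linear_op X scalars \<phi> \<and> (\<forall>x. x \<notin> vset X \<longrightarrow> \<phi> x = 0)},
      vadd = (\<lambda>\<phi> \<psi> x. \<phi> x + \<psi> x),
      vzero = (\<lambda>x. 0),
      vscale = (\<lambda>c \<phi> x. c * \<phi> x),
      vnorm = op_norm X scalars\<rparr>"

abbreviation bidual ::
    "('k::real_normed_field, 'v) nspace \<Rightarrow> ('k, ('v \<Rightarrow> 'k) \<Rightarrow> 'k) nspace" where
  "bidual X \<equiv> dual (dual X)"

definition rank_one :: "('k, 'v) nspace \<Rightarrow> ('k, 'w) nspace \<Rightarrow> ('v \<Rightarrow> 'w) \<Rightarrow> bool" where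
  "rank_one X Y R \<longleftrightarrow>
     (\<exists>y\<in>vset Y. y \<noteq> vzero Y \<and> R ` vset X = range (\<lambda>c. vscale Y c y))"

definition daugavet_property :: "('k, 'v) nspace \<Rightarrow> bool" where
  "daugavet_property Y \<longleftrightarrow>
     (\<forall>R. bounded_linear_op Y Y R \<and> rank_one Y Y R \<longrightarrow>
        op_norm Y Y (\<lambda>x. vadd Y x (R x)) = 1 + op_norm Y Y R)"

definition atomless :: "'a measure \<Rightarrow> bool" where
  "atomless M \<longleftrightarrow>
     (\<forall>A\<in>sets M. emeasure M A > 0 \<longrightarrow>
        (\<exists>B\<in>sets M. B \<subseteq> A \<and> 0 < emeasure M B \<and> emeasure M B < emeasure M A))"

definition invertible_mpt :: "'a measure \<Rightarrow> ('a \<Rightarrow> 'a) \<Rightarrow> bool" where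
  "invertible_mpt M T \<longleftrightarrow>
     bij_betw T (space M) (space M) \<and>
     T \<in> measurable M M \<and>
     the_inv_into (space M) T \<in> measurable M M \<and>
     (\<forall>A\<in>sets M. emeasure M (T -` A \<inter> space M) = emeasure M A)"

definition int_iterate :: "'a measure \<Rightarrow> ('a \<Rightarrow> 'a) \<Rightarrow> int \<Rightarrow> 'a \<Rightarrow> 'a" where
  "int_iterate M T k =
     (if k \<ge> 0 then T ^^ nat k else the_inv_into (space M) T ^^ nat (- k))"

text \<open>
  For integrable \<open>f\<close> the series converges almost everywhere (when \<open>T\<close> is an invertible measure
  preserving transformation and the \<open>sqrt (a k)\<close> are summable), so the value \<open>0\<close> that \<open>infsum\<close>
  takes on divergent series does not affect the integral.
\<close>

definition square_norm ::
    "'a measure \<Rightarrow> ('a \<Rightarrow> 'a) \<Rightarrow> (int \<Rightarrow> real) \<Rightarrow> ('a \<Rightarrow> 'k::real_normed_field) \<Rightarrow> real" where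
  "square_norm M T a f =
     (LINT \<omega>|M. sqrt (\<Sum>\<^sub>\<infinity>k\<in>UNIV. a k * (norm (f (int_iterate M T k \<omega>)))\<^sup>2))"

definition ae_rel ::
    "'a measure \<Rightarrow>
     (('a \<Rightarrow> 'k::{real_normed_field, banach, second_countable_topology}) \<times> ('a \<Rightarrow> 'k)) set" where
  "ae_rel M = {(f, g). integrable M f \<and> integrable M g \<and> (AE x in M. f x = g x)}"

text \<open>
  The elements are the almost-everywhere classes of integrable functions. The operations and the
  norm are constant on classes; \<open>the_elem\<close> picks the common value of \<open>square_norm\<close> on a class.
\<close>

definition renormed_L1 ::
    "'a measure \<Rightarrow> ('a \<Rightarrow> 'a) \<Rightarrow> (int \<Rightarrow> real) \<Rightarrow>
     ('k::{real_normed_field, banach, second_countable_topology}, ('a \<Rightarrow> 'k) set) nspace" where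
  "renormed_L1 M T a =
     \<lparr>vset = {f. integrable M f} // ae_rel M,
      vadd = (\<lambda>A B. \<Union>f\<in>A. \<Union>g\<in>B. ae_rel M `` {\<lambda>x. f x + g x}),
      vzero = ae_rel M `` {\<lambda>x. 0},
      vscale = (\<lambda>c A. \<Union>f\<in>A. ae_rel M `` {\<lambda>x. c * f x}),
      vnorm = (\<lambda>A. the_elem (square_norm M T a ` A))\<rparr>"

end

theory Submission imports Defs begin

text \<open>
  The norm \<open>|||\<cdot>|||\<close> is a lattice norm (\<open>square_norm_mono\<close>), equivalent to the \<open>L\<^sub>1\<close>-norm
  (\<open>square_norm_le\<close>, \<open>square_norm_ge\<close>). So the dual of \<open>X\<close> is \<open>L\<^sub>\<infinity>(\<mu>)\<close>, and the bidual is the space of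
  measures on the spectrum of \<open>L\<^sub>\<infinity>(\<mu>)\<close>, both with equivalent lattice norms. A space of measures has
  atoms: let \<open>p\<close> be the point mass at some character of \<open>L\<^sub>\<infinity>(\<mu>)\<close>. Removing from a measure its part at
  that point is a band projection, hence a contraction; it is \<open>I + R\<close>, where \<open>R\<close> is minus the rank-one
  projection onto the span of \<open>p\<close>. Therefore \<open>\<parallel>I + R\<parallel> \<le> 1 < 1 + \<parallel>R\<parallel>\<close>.

  The spectrum is not constructed. A character of \<open>L\<^sub>\<infinity>(\<mu>)\<close> is the limit along an ultrafilter \<open>U\<close> of
  sets of positive measure, and the part of \<open>G\<close> at that character is the limit of the
  restrictions \<open>\<phi> \<mapsto> G (\<phi> \<circ> P\<^sub>A)\<close>, where \<open>P\<^sub>A\<close> is multiplication by the indicator of \<open>A\<close> and \<open>A\<close> shrinks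
  along \<open>U\<close>. A second ultrafilter \<open>W\<close>, on sets, makes all these limits exist (\<open>shrinking_sets\<close>,
  \<open>ultra_tendsto\<close>). That the limit is a multiple of \<open>p\<close> (\<open>atom_tendsto\<close>) holds because \<open>\<phi>\<close> has a bounded
  density (\<open>bounded_functional_density\<close>), which is nearly constant on small members of \<open>U\<close>
  (\<open>functional_concentrates\<close>). The locale \<open>shrinking_bands\<close> isolates what is used of \<open>X\<close>, and
  \<open>bidual_not_daugavet\<close> draws the conclusion there.
\<close>

section \<open>Ultrafilters\<close>

definition ultra :: "'a filter \<Rightarrow> bool" where
  "ultra U \<longleftrightarrow> U \<noteq> bot \<and> (\<forall>P. eventually P U \<or> eventually (\<lambda>x. \<not> P x) U)"

text \<open>
  Zorn's lemma, applied to the proper filters below \<open>F\<close>: the infimum of a chain of proper filters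
  is proper. A minimal proper filter decides every predicate, for otherwise intersecting it with
  that predicate would give a smaller one.
\<close>

lemma ultra_below:
  assumes "F \<noteq> (bot :: 'a filter)"
  obtains U where "U \<le> F" "ultra U"
proof -
  define \<A> where "\<A> = {G. G \<noteq> bot \<and> G \<le> F}"
  have po: "partial_order_on \<A> (relation_of (\<lambda>a b. b \<le> a) \<A>)"
    by (auto simp: relation_of_def partial_order_on_def preorder_on_def refl_on_def trans_def antisym_def)
  have ch: "\<exists>u\<in>\<A>. \<forall>a\<in>C. u \<le> a" if C: "C \<in> Chains (relation_of (\<lambda>a b. b \<le> a) \<A>)" for C
  proof (cases "C = {}")
    case True
    then show ?thesis using assms by (auto simp: \<A>_def)
  next
    case False
    have sub: "C \<subseteq> \<A>" and lin: "\<And>a b. a \<in> C \<Longrightarrow> b \<in> C \<Longrightarrow> a \<le> b \<or> b \<le> a"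
      using C by (auto simp: Chains_def relation_of_def)
    have "(\<Sqinter>a\<in>C. a) \<noteq> bot"
    proof (subst INF_filter_bot_base)
      show "\<exists>k\<in>C. k \<le> i \<sqinter> j" if "i \<in> C" "j \<in> C" for i j
        using lin[OF that] that by (auto simp: le_inf_iff)
    qed (use sub in \<open>auto simp: \<A>_def\<close>)
    moreover have "(\<Sqinter>a\<in>C. a) \<le> F"
    proof -
      obtain a where "a \<in> C" using False by blast
      then show ?thesis using sub by (intro INF_lower2[of a]) (auto simp: \<A>_def)
    qed
    ultimately show ?thesis
      by (intro bexI[of _ "\<Sqinter>a\<in>C. a"]) (auto simp: \<A>_def intro: Inf_lower)
  qed
  obtain U where U: "U \<noteq> bot" "U \<le> F" and max: "\<And>G. G \<noteq> bot \<Longrightarrow> G \<le> U \<Longrightarrow> G = U"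
    using predicate_Zorn[OF po ch] unfolding \<A>_def by (auto intro: order_trans)
  have "eventually P U \<or> eventually (\<lambda>x. \<not> P x) U" for P
  proof (cases "inf U (principal {x. P x}) = bot")
    case True
    then show ?thesis by (simp add: trivial_limit_def eventually_inf_principal)
  next
    case False
    with max have "U \<le> principal {x. P x}" by (metis inf.cobounded1 inf.cobounded2)
    then show ?thesis by (auto simp: le_principal)
  qed
  with U show thesis by (intro that) (auto simp: ultra_def)
qed

text \<open>
  A bounded function has a cluster point by compactness, and along an ultrafilter a cluster point
  is a limit. This replaces every argument about convergence of nets of functionals below.
\<close>

lemma ultra_tendsto:
  fixes f :: "'a \<Rightarrow> 'b::heine_borel"
  assumes U: "ultra U" and f: "eventually (\<lambda>x. f x \<in> K) U" and K: "bounded K"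
  obtains l where "(f \<longlongrightarrow> l) U"
proof -
  have "compact (closure K)" using K by (simp add: compact_closure)
  moreover have "filtermap f U \<noteq> bot" using U by (simp add: ultra_def filtermap_bot_iff)
  moreover have "eventually (\<lambda>y. y \<in> closure K) (filtermap f U)"
    unfolding eventually_filtermap using f by eventually_elim (use closure_subset in auto)
  ultimately obtain l where l: "inf (nhds l) (filtermap f U) \<noteq> bot"
    unfolding compact_filter by blast
  have "eventually (\<lambda>x. f x \<in> S) U" if "open S" "l \<in> S" for S
  proof (rule ccontr)
    assume "\<not> eventually (\<lambda>x. f x \<in> S) U"
    with U have "eventually (\<lambda>x. f x \<notin> S) U" unfolding ultra_def by blast
    then have "eventually (\<lambda>y. y \<notin> S) (filtermap f U)" by (simp add: eventually_filtermap)
    moreover have "eventually (\<lambda>y. y \<in> S) (nhds l)" using that by (rule eventually_nhds_in_open)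
    ultimately have "eventually (\<lambda>y. False) (inf (nhds l) (filtermap f U))"
      unfolding eventually_inf by blast
    with l show False by (simp add: trivial_limit_def)
  qed
  then show thesis by (intro that topological_tendstoI)
qed

section \<open>Duals and pullbacks of functionals\<close>

text \<open>
  The part of the norm axioms that makes \<^const>\<open>op_norm\<close> a best Lipschitz constant. It passes from a
  space to its dual.
\<close>

definition homogeneous :: "('k::real_normed_field, 'v) nspace \<Rightarrow> bool" where
  "homogeneous X \<longleftrightarrow> vset X \<noteq> {} \<and> (\<forall>x\<in>vset X. 0 \<le> vnorm X x) \<and>
     (\<forall>c. \<forall>x\<in>vset X. vscale X c x \<in> vset X \<and> vnorm X (vscale X c x) = norm c * vnorm X x)"

lemma homogeneous_scalars: "homogeneous (scalars :: ('k::real_normed_field, 'k) nspace)"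
  by (auto simp: homogeneous_def scalars_def norm_mult)

lemma unit_ball_nonempty:
  assumes "homogeneous X"
  shows "{x \<in> vset X. vnorm X x \<le> 1} \<noteq> {}"
proof -
  obtain x where "x \<in> vset X" using assms by (auto simp: homogeneous_def)
  then have "vscale X 0 x \<in> {x \<in> vset X. vnorm X x \<le> 1}"
    using assms by (simp add: homogeneous_def)
  then show ?thesis by blast
qed

lemma op_norm_least:
  assumes "homogeneous X" "\<And>x. x \<in> vset X \<Longrightarrow> vnorm X x \<le> 1 \<Longrightarrow> vnorm Y (R x) \<le> K"
  shows "op_norm X Y R \<le> K"
  unfolding op_norm_def using assms(2) by (intro cSUP_least unit_ball_nonempty assms(1)) auto

lemma op_norm_upper:
  assumes X: "homogeneous X" and R: "bounded_linear_op X Y R"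
    and x: "x \<in> vset X" "vnorm X x \<le> 1"
  shows "vnorm Y (R x) \<le> op_norm X Y R"
  unfolding op_norm_def
proof (rule cSUP_upper)
  obtain C where C: "\<forall>x\<in>vset X. vnorm Y (R x) \<le> C * vnorm X x"
    using R by (auto simp: bounded_linear_op_def)
  show "bdd_above ((\<lambda>x. vnorm Y (R x)) ` {x \<in> vset X. vnorm X x \<le> 1})"
  proof (rule bdd_aboveI2)
    fix x assume x: "x \<in> {x \<in> vset X. vnorm X x \<le> 1}"
    have "vnorm Y (R x) \<le> C * vnorm X x" using C x by simp
    also have "\<dots> \<le> \<bar>C\<bar> * 1" using x X by (intro mult_mono) (auto simp: homogeneous_def)
    finally show "vnorm Y (R x) \<le> \<bar>C\<bar>" by simp
  qed
qed (use x in simp)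

lemma op_norm_bound:
  fixes X :: "('k::real_normed_field, 'v) nspace"
  assumes X: "homogeneous X" and Y: "homogeneous Y" and R: "bounded_linear_op X Y R"
    and x: "x \<in> vset X"
  shows "vnorm Y (R x) \<le> op_norm X Y R * vnorm X x"
proof (cases "vnorm X x = 0")
  case True
  obtain C where "vnorm Y (R x) \<le> C * vnorm X x" using R x by (auto simp: bounded_linear_op_def)
  with True show ?thesis by simp
next
  case False
  then have pos: "vnorm X x > 0" using X x by (force simp: homogeneous_def)
  let ?c = "of_real (1 / vnorm X x) :: 'k"
  let ?y = "vscale X ?c x"
  have y: "?y \<in> vset X" "vnorm X ?y = 1"
    using X x pos by (auto simp: homogeneous_def norm_divide)
  have Rx: "R x \<in> vset Y" using R x by (simp add: bounded_linear_op_def)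
  have "vnorm Y (R x) / vnorm X x = vnorm Y (vscale Y ?c (R x))"
    using Y Rx pos by (simp add: homogeneous_def norm_divide)
  also have "\<dots> = vnorm Y (R ?y)" using R x by (simp add: bounded_linear_op_def)
  also have "\<dots> \<le> op_norm X Y R"
    using y by (intro op_norm_upper[OF X R]) auto
  finally show ?thesis using pos by (simp add: field_simps)
qed

lemma op_norm_nonneg:
  assumes X: "homogeneous X" and Y: "homogeneous Y" and R: "bounded_linear_op X Y R"
  shows "0 \<le> op_norm X Y R"
proof -
  obtain x where x: "x \<in> vset X" "vnorm X x \<le> 1" using unit_ball_nonempty[OF X] by blast
  have "0 \<le> vnorm Y (R x)" using R Y x by (simp add: bounded_linear_op_def homogeneous_def)
  also have "\<dots> \<le> op_norm X Y R"
    using x by (intro op_norm_upper[OF X R])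
  finally show ?thesis .
qed

lemma vset_dual:
  "\<phi> \<in> vset (dual X) \<longleftrightarrow>
     (\<forall>x\<in>vset X. \<forall>y\<in>vset X. \<phi> (vadd X x y) = \<phi> x + \<phi> y) \<and>
     (\<forall>c. \<forall>x\<in>vset X. \<phi> (vscale X c x) = c * \<phi> x) \<and>
     (\<exists>C. \<forall>x\<in>vset X. norm (\<phi> x) \<le> C * vnorm X x) \<and> (\<forall>x. x \<notin> vset X \<longrightarrow> \<phi> x = 0)"
  by (auto simp: dual_def bounded_linear_op_def scalars_def)

lemma dual_apply:
  assumes "\<phi> \<in> vset (dual X)" "x \<in> vset X"
  shows "y \<in> vset X \<Longrightarrow> \<phi> (vadd X x y) = \<phi> x + \<phi> y" "\<phi> (vscale X c x) = c * \<phi> x"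
  using assms by (simp_all add: vset_dual)

lemma dual_ops [simp]:
  "vadd (dual X) \<phi> \<psi> = (\<lambda>x. \<phi> x + \<psi> x)" "vscale (dual X) c \<phi> = (\<lambda>x. c * \<phi> x)"
  "vzero (dual X) = (\<lambda>x. 0)"
  by (simp_all add: dual_def)

lemma dual_bound:
  assumes "homogeneous X" "\<phi> \<in> vset (dual X)" "x \<in> vset X"
  shows "norm (\<phi> x) \<le> vnorm (dual X) \<phi> * vnorm X x"
  using op_norm_bound[OF assms(1) homogeneous_scalars _ assms(3), of \<phi>] assms(2)
  by (simp add: dual_def scalars_def)

lemma dual_norm_nonneg:
  assumes "homogeneous X" "\<phi> \<in> vset (dual X)"
  shows "0 \<le> vnorm (dual X) \<phi>"
  using op_norm_nonneg[OF assms(1) homogeneous_scalars, of \<phi>] assms(2) by (simp add: dual_def)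

lemma dual_norm_least:
  assumes "homogeneous X" "\<And>x. x \<in> vset X \<Longrightarrow> vnorm X x \<le> 1 \<Longrightarrow> norm (\<phi> x) \<le> K"
  shows "vnorm (dual X) \<phi> \<le> K"
  using op_norm_least[OF assms(1), of scalars \<phi> K] assms(2) by (simp add: dual_def scalars_def)

lemma dual_scale:
  assumes \<phi>: "\<phi> \<in> vset (dual X)"
  shows "(\<lambda>x. c * \<phi> x) \<in> vset (dual X)"
proof -
  obtain C where C: "\<forall>x\<in>vset X. norm (\<phi> x) \<le> C * vnorm X x"
    using \<phi> by (auto simp: vset_dual)
  have "\<exists>C. \<forall>x\<in>vset X. norm (c * \<phi> x) \<le> C * vnorm X x"
    using C by (intro exI[of _ "norm c * C"]) (auto simp: norm_mult mult.assoc intro!: mult_left_mono)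
  with \<phi> show ?thesis by (simp add: vset_dual algebra_simps)
qed

lemma dual_add:
  assumes \<phi>: "\<phi> \<in> vset (dual X)" and \<psi>: "\<psi> \<in> vset (dual X)"
  shows "(\<lambda>x. \<phi> x + \<psi> x) \<in> vset (dual X)"
proof -
  obtain C D where "\<forall>x\<in>vset X. norm (\<phi> x) \<le> C * vnorm X x"
    "\<forall>x\<in>vset X. norm (\<psi> x) \<le> D * vnorm X x"
    using \<phi> \<psi> by (auto simp: vset_dual)
  then have "\<exists>C. \<forall>x\<in>vset X. norm (\<phi> x + \<psi> x) \<le> C * vnorm X x"
    by (intro exI[of _ "C + D"]) (auto simp: distrib_right intro!: norm_triangle_mono)
  with \<phi> \<psi> show ?thesis by (simp add: vset_dual algebra_simps)
qed

lemma dual_norm_scale: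
  assumes X: "homogeneous X" and \<phi>: "\<phi> \<in> vset (dual X)"
  shows "vnorm (dual X) (\<lambda>x. c * \<phi> x) = norm c * vnorm (dual X) \<phi>"
proof -
  have le: "vnorm (dual X) (\<lambda>x. c * \<psi> x) \<le> norm c * vnorm (dual X) \<psi>"
    if \<psi>: "\<psi> \<in> vset (dual X)" for c and \<psi>
  proof (rule dual_norm_least[OF X])
    fix x assume x: "x \<in> vset X" "vnorm X x \<le> 1"
    have "norm (\<psi> x) \<le> vnorm (dual X) \<psi> * vnorm X x" using dual_bound[OF X \<psi> x(1)] .
    also have "\<dots> \<le> vnorm (dual X) \<psi>"
      using x dual_norm_nonneg[OF X \<psi>] by (intro mult_left_le) auto
    finally show "norm (c * \<psi> x) \<le> norm c * vnorm (dual X) \<psi>"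
      by (simp add: norm_mult mult_left_mono)
  qed
  show ?thesis
  proof (cases "c = 0")
    case True
    then show ?thesis
      using le[OF \<phi>, of 0] dual_norm_nonneg[OF X dual_scale[OF \<phi>, of 0]] by simp
  next
    case False
    have "vnorm (dual X) (\<lambda>x. inverse c * (c * \<phi> x)) \<le> norm (inverse c) * vnorm (dual X) (\<lambda>x. c * \<phi> x)"
      by (rule le[OF dual_scale[OF \<phi>]])
    with False have "norm c * vnorm (dual X) \<phi> \<le> vnorm (dual X) (\<lambda>x. c * \<phi> x)"
      by (simp add: mult.assoc[symmetric] norm_inverse norm_divide field_simps)
    with le[OF \<phi>, of c] show ?thesis by simp
  qed
qed

lemma homogeneous_dual:
  fixes X :: "('k::real_normed_field, 'v) nspace"
  assumes X: "homogeneous X"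
  shows "homogeneous (dual X)"
proof -
  have "(\<lambda>x. 0) \<in> vset (dual X)" by (auto simp: vset_dual intro: exI[of _ 0])
  then show ?thesis
    unfolding homogeneous_def
    using dual_norm_nonneg[OF X] dual_norm_scale[OF X] dual_scale by auto
qed

text \<open>
  The adjoint of \<open>P\<close>. The value \<open>0\<close> off the carrier is what membership in \<^const>\<open>dual\<close> requires.
\<close>

definition pullback :: "('k::real_normed_field, 'v) nspace \<Rightarrow> ('v \<Rightarrow> 'v) \<Rightarrow> ('v \<Rightarrow> 'k) \<Rightarrow> 'v \<Rightarrow> 'k" where
  "pullback X P \<phi> = (\<lambda>x. if x \<in> vset X then \<phi> (P x) else 0)"

definition contraction :: "('k::real_normed_field, 'v) nspace \<Rightarrow> ('v \<Rightarrow> 'v) \<Rightarrow> bool" where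
  "contraction X P \<longleftrightarrow> bounded_linear_op X X P \<and> (\<forall>x\<in>vset X. vnorm X (P x) \<le> vnorm X x)"

lemma pullback_bound:
  assumes X: "homogeneous X" and P: "contraction X P" and \<phi>: "\<phi> \<in> vset (dual X)" and x: "x \<in> vset X"
  shows "norm (\<phi> (P x)) \<le> vnorm (dual X) \<phi> * vnorm X x"
proof -
  have "norm (\<phi> (P x)) \<le> vnorm (dual X) \<phi> * vnorm X (P x)"
    using P x by (intro dual_bound[OF X \<phi>]) (simp add: contraction_def bounded_linear_op_def)
  also have "\<dots> \<le> vnorm (dual X) \<phi> * vnorm X x"
    using P x dual_norm_nonneg[OF X \<phi>] by (intro mult_left_mono) (auto simp: contraction_def)
  finally show ?thesis .
qed

lemma pullback_dual:
  assumes X: "homogeneous X" and add: "\<And>x y. x \<in> vset X \<Longrightarrow> y \<in> vset X \<Longrightarrow> vadd X x y \<in> vset X"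
    and P: "contraction X P" and \<phi>: "\<phi> \<in> vset (dual X)"
  shows "pullback X P \<phi> \<in> vset (dual X)"
proof -
  have "\<exists>C. \<forall>x\<in>vset X. norm (\<phi> (P x)) \<le> C * vnorm X x"
    using pullback_bound[OF X P \<phi>] by blast
  moreover have "vscale X c x \<in> vset X" if "x \<in> vset X" for c x
    using that X by (simp add: homogeneous_def)
  ultimately show ?thesis
    using P \<phi> add by (simp add: vset_dual pullback_def contraction_def bounded_linear_op_def)
qed

lemma pullback_norm:
  assumes X: "homogeneous X" and P: "contraction X P" and \<phi>: "\<phi> \<in> vset (dual X)"
  shows "vnorm (dual X) (pullback X P \<phi>) \<le> vnorm (dual X) \<phi>"
proof (rule dual_norm_least[OF X])
  fix x assume x: "x \<in> vset X" "vnorm X x \<le> 1"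
  have "norm (\<phi> (P x)) \<le> vnorm (dual X) \<phi> * vnorm X x" by (rule pullback_bound[OF X P \<phi> x(1)])
  also have "\<dots> \<le> vnorm (dual X) \<phi>"
    using x dual_norm_nonneg[OF X \<phi>] by (intro mult_left_le) auto
  finally show "norm (pullback X P \<phi> x) \<le> vnorm (dual X) \<phi>" using x by (simp add: pullback_def)
qed

section \<open>An atom of the bidual\<close>

text \<open>
  In a function space, \<open>P i\<close> is multiplication by the indicator of a set \<open>A\<^sub>i\<close>, \<open>Q i\<close> is
  multiplication by the indicator of the complement, \<open>\<tau>\<close> is the integral, and \<open>e i\<close> is the
  normalized indicator of \<open>A\<^sub>i\<close>; the sets shrink along \<open>W\<close>. The last assumption says that every
  functional looks, on small sets, like a multiple of \<open>\<tau>\<close>: its density is nearly constant there.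
\<close>

locale shrinking_bands =
  fixes X :: "('k::{real_normed_field, heine_borel}, 'v) nspace"
    and W :: "'i filter" and I :: "'i set"
    and P Q :: "'i \<Rightarrow> 'v \<Rightarrow> 'v" and e :: "'i \<Rightarrow> 'v" and \<tau> :: "'v \<Rightarrow> 'k" and S :: real
  assumes X: "homogeneous X"
    and add: "\<And>x y. x \<in> vset X \<Longrightarrow> y \<in> vset X \<Longrightarrow> vadd X x y \<in> vset X"
    and W: "ultra W" and I: "eventually (\<lambda>i. i \<in> I) W"
    and P: "\<And>i. i \<in> I \<Longrightarrow> contraction X (P i)"
    and Q: "\<And>i. i \<in> I \<Longrightarrow> contraction X (Q i)"
    and PQ: "\<And>i x. i \<in> I \<Longrightarrow> x \<in> vset X \<Longrightarrow> vadd X (P i x) (Q i x) = x"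
    and \<tau>: "\<tau> \<in> vset (dual X)"
    and e: "\<And>i. i \<in> I \<Longrightarrow> e i \<in> vset X \<and> vnorm X (e i) \<le> S"
    and Pe: "\<And>i. i \<in> I \<Longrightarrow> eventually (\<lambda>j. P i (e j) = e j) W"
    and Pe_same: "\<And>i. i \<in> I \<Longrightarrow> P i (e i) = e i"
    and \<tau>e: "\<And>i. i \<in> I \<Longrightarrow> \<tau> (e i) = 1"
    and conc: "\<And>\<phi>. \<phi> \<in> vset (dual X) \<Longrightarrow> \<exists>c. \<forall>\<epsilon>>0. eventually (\<lambda>i.
       \<forall>x\<in>vset X. norm (\<phi> (P i x) - c * \<tau> (P i x)) \<le> \<epsilon> * vnorm X x) W"
begin

text \<open>
  The atom: the weak-star limit in the bidual of the vectors \<open>e i\<close>. On densities it is evaluation at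
  the point to which the sets shrink.
\<close>

definition p :: "('v \<Rightarrow> 'k) \<Rightarrow> 'k" where
  "p \<phi> = (if \<phi> \<in> vset (dual X) then Lim W (\<lambda>i. \<phi> (e i)) else 0)"

text \<open>
  The amount of the atom that is contained in \<open>G\<close>, read off from the restrictions of \<open>G\<close> to the
  shrinking sets.
\<close>

definition mass :: "(('v \<Rightarrow> 'k) \<Rightarrow> 'k) \<Rightarrow> 'k" where
  "mass G = Lim W (\<lambda>i. G (pullback X (P i) \<tau>))"

lemma W_nontrivial [simp]: "W \<noteq> bot" using W by (simp add: ultra_def)

lemmas dX = homogeneous_dual[OF X]
lemmas ddX = homogeneous_dual[OF dX]

lemma S_nonneg: "0 \<le> S"
proof -
  obtain i where "i \<in> I" using I W_nontrivial eventually_happens by blast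
  with e[of i] X show ?thesis by (force simp: homogeneous_def)
qed

lemma e_bound:
  assumes "\<phi> \<in> vset (dual X)" "i \<in> I"
  shows "norm (\<phi> (e i)) \<le> vnorm (dual X) \<phi> * S"
  using dual_bound[OF X assms(1), of "e i"] e[OF assms(2)]
    mult_left_mono[OF _ dual_norm_nonneg[OF X assms(1)], of "vnorm X (e i)" S] by auto

lemma p_tendsto:
  assumes \<phi>: "\<phi> \<in> vset (dual X)"
  shows "((\<lambda>i. \<phi> (e i)) \<longlongrightarrow> p \<phi>) W"
proof -
  have "eventually (\<lambda>i. \<phi> (e i) \<in> cball 0 (vnorm (dual X) \<phi> * S)) W"
    using I by eventually_elim (use e_bound[OF \<phi>] in simp)
  then obtain l where "((\<lambda>i. \<phi> (e i)) \<longlongrightarrow> l) W"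
    by (rule ultra_tendsto[OF W _ bounded_cball])
  with \<phi> show ?thesis by (simp add: p_def tendsto_Lim)
qed

lemma p_eq:
  assumes \<phi>: "\<phi> \<in> vset (dual X)" and "((\<lambda>i. \<phi> (e i)) \<longlongrightarrow> l) W"
  shows "p \<phi> = l"
  using tendsto_unique[OF W_nontrivial p_tendsto[OF \<phi>] assms(2)] .

lemma p_bidual: "p \<in> vset (bidual X)"
proof -
  have "p (\<lambda>x. \<phi> x + \<psi> x) = p \<phi> + p \<psi>" if "\<phi> \<in> vset (dual X)" "\<psi> \<in> vset (dual X)" for \<phi> \<psi>
    using that by (intro p_eq dual_add tendsto_add p_tendsto)
  moreover have "p (\<lambda>x. c * \<phi> x) = c * p \<phi>" if "\<phi> \<in> vset (dual X)" for c \<phi>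
    using that by (intro p_eq dual_scale tendsto_mult tendsto_const p_tendsto)
  moreover have "norm (p \<phi>) \<le> S * vnorm (dual X) \<phi>" if \<phi>: "\<phi> \<in> vset (dual X)" for \<phi>
  proof (rule tendsto_upperbound[OF tendsto_norm[OF p_tendsto[OF \<phi>]]])
    show "\<forall>\<^sub>F i in W. norm (\<phi> (e i)) \<le> S * vnorm (dual X) \<phi>"
      using I by eventually_elim (use e_bound[OF \<phi>] in \<open>simp add: mult.commute\<close>)
  qed simp
  ultimately show ?thesis
    unfolding vset_dual[of p] by (auto intro!: exI[of _ S]) (simp add: p_def)
qed

lemma pull:
  assumes "i \<in> I" "\<phi> \<in> vset (dual X)"
  shows "pullback X (P i) \<phi> \<in> vset (dual X)" "pullback X (Q i) \<phi> \<in> vset (dual X)"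
  using assms by (auto intro!: pullback_dual[OF X add] P Q)

lemma bidual_add:
  assumes "G \<in> vset (bidual X)" "\<phi> \<in> vset (dual X)" "\<psi> \<in> vset (dual X)"
  shows "G (\<lambda>x. \<phi> x + \<psi> x) = G \<phi> + G \<psi>"
  using assms by (simp add: vset_dual[of G])

lemma bidual_scale:
  assumes "G \<in> vset (bidual X)" "\<phi> \<in> vset (dual X)"
  shows "G (\<lambda>x. c * \<phi> x) = c * G \<phi>"
  using assms by (simp add: vset_dual[of G])

lemma bidual_pull_bound:
  assumes G: "G \<in> vset (bidual X)" and \<phi>: "\<phi> \<in> vset (dual X)" and i: "i \<in> I"
  shows "norm (G (pullback X (P i) \<phi>)) \<le> vnorm (bidual X) G * vnorm (dual X) \<phi>"
    "norm (G (pullback X (Q i) \<phi>)) \<le> vnorm (bidual X) G * vnorm (dual X) \<phi>"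
  using dual_bound[OF dX G] pull[OF i \<phi>] dual_norm_nonneg[OF dX G]
    pullback_norm[OF X P[OF i] \<phi>] pullback_norm[OF X Q[OF i] \<phi>]
  by (meson mult_left_mono order_trans)+

lemma mass_tendsto:
  assumes G: "G \<in> vset (bidual X)"
  shows "((\<lambda>i. G (pullback X (P i) \<tau>)) \<longlongrightarrow> mass G) W"
proof -
  have "eventually (\<lambda>i. G (pullback X (P i) \<tau>) \<in>
      cball 0 (vnorm (bidual X) G * vnorm (dual X) \<tau>)) W"
    using I by eventually_elim (use bidual_pull_bound(1)[OF G \<tau>] in simp)
  then obtain l where "((\<lambda>i. G (pullback X (P i) \<tau>)) \<longlongrightarrow> l) W"
    by (rule ultra_tendsto[OF W _ bounded_cball])
  then show ?thesis by (simp add: mass_def tendsto_Lim)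
qed

lemma mass_eq:
  assumes G: "G \<in> vset (bidual X)" and "((\<lambda>i. G (pullback X (P i) \<tau>)) \<longlongrightarrow> l) W"
  shows "mass G = l"
  using tendsto_unique[OF W_nontrivial mass_tendsto[OF G] assms(2)] .

lemma p_\<tau>: "p \<tau> = 1"
proof (rule p_eq[OF \<tau>])
  have "eventually (\<lambda>i. 1 = \<tau> (e i)) W" using I by eventually_elim (simp add: \<tau>e)
  then show "((\<lambda>i. \<tau> (e i)) \<longlongrightarrow> 1) W" by (rule Lim_transform_eventually[OF tendsto_const])
qed

text \<open>
  This iterated limit, first in \<open>j\<close> and then in \<open>i\<close>, is harmless since \<open>P i\<close> fixes \<open>e j\<close> for late \<open>j\<close>.
\<close>

lemma mass_p: "mass p = 1"
proof (rule mass_eq[OF p_bidual])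
  have "p (pullback X (P i) \<tau>) = 1" if i: "i \<in> I" for i
  proof (rule p_eq[OF pull(1)[OF i \<tau>]])
    have "eventually (\<lambda>j. 1 = pullback X (P i) \<tau> (e j)) W"
      using I Pe[OF i] by eventually_elim (simp add: \<tau>e pullback_def e)
    then show "((\<lambda>j. pullback X (P i) \<tau> (e j)) \<longlongrightarrow> 1) W"
      by (rule Lim_transform_eventually[OF tendsto_const])
  qed
  then have "eventually (\<lambda>i. 1 = p (pullback X (P i) \<tau>)) W"
    by (intro eventually_mono[OF I]) simp
  then show "((\<lambda>i. p (pullback X (P i) \<tau>)) \<longlongrightarrow> 1) W"
    by (rule Lim_transform_eventually[OF tendsto_const])
qed

text \<open>
  The heart of the matter: the restrictions of \<open>G\<close> to the shrinking sets converge to a multiple of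
  \<open>p\<close>. By concentration the pullback of \<open>\<phi>\<close> along \<open>P i\<close> differs from \<open>c\<close> times the pullback of \<open>\<tau>\<close>
  by a functional \<open>D i\<close> of small norm, on which \<open>G\<close> is small. Testing concentration on \<open>e i\<close>
  identifies \<open>c\<close> as \<open>p \<phi>\<close>.
\<close>

lemma atom_tendsto:
  assumes G: "G \<in> vset (bidual X)" and \<phi>: "\<phi> \<in> vset (dual X)"
  shows "((\<lambda>i. G (pullback X (P i) \<phi>)) \<longlongrightarrow> p \<phi> * mass G) W"
proof -
  obtain c where c: "\<And>\<epsilon>. \<epsilon> > 0 \<Longrightarrow> eventually (\<lambda>i.
       \<forall>x\<in>vset X. norm (\<phi> (P i x) - c * \<tau> (P i x)) \<le> \<epsilon> * vnorm X x) W"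
    using conc[OF \<phi>] by blast
  have "p \<phi> = c"
  proof (rule p_eq[OF \<phi>], rule tendstoI)
    fix \<epsilon> :: real assume \<epsilon>: "\<epsilon> > 0"
    \<comment> \<open>the summand \<open>1\<close> keeps the quotient defined when the bound \<open>S\<close> vanishes\<close>
    define \<delta> where "\<delta> = \<epsilon> / (S + 1)"
    have \<delta>: "\<delta> > 0" "\<delta> * S < \<epsilon>" using \<epsilon> S_nonneg by (simp_all add: \<delta>_def field_simps)
    show "eventually (\<lambda>i. dist (\<phi> (e i)) c < \<epsilon>) W"
      using c[OF \<delta>(1)] I
    proof eventually_elim
      case (elim i)
      have "norm (\<phi> (P i (e i)) - c * \<tau> (P i (e i))) \<le> \<delta> * vnorm X (e i)"
        using elim e by blast
      also have "\<dots> \<le> \<delta> * S" using \<delta>(1) e[OF elim(2)] by (intro mult_left_mono) auto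
      finally show ?case using \<delta> Pe_same[OF elim(2)] \<tau>e[OF elim(2)] by (simp add: dist_norm)
    qed
  qed
  define D where "D i = (\<lambda>x. pullback X (P i) \<phi> x + (- c) * pullback X (P i) \<tau> x)" for i
  have D: "(\<lambda>x. (- c) * pullback X (P i) \<tau> x) \<in> vset (dual X)" "D i \<in> vset (dual X)"
    if i: "i \<in> I" for i
    unfolding D_def by (intro dual_add dual_scale pull(1)[OF i] \<phi> \<tau>)+
  have GD: "G (D i) + c * G (pullback X (P i) \<tau>) = G (pullback X (P i) \<phi>)" if i: "i \<in> I" for i
  proof -
    have "G (D i) = G (pullback X (P i) \<phi>) + G (\<lambda>x. (- c) * pullback X (P i) \<tau> x)"
      unfolding D_def by (rule bidual_add[OF G pull(1)[OF i \<phi>] D(1)[OF i]])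
    also have "G (\<lambda>x. (- c) * pullback X (P i) \<tau> x) = (- c) * G (pullback X (P i) \<tau>)"
      by (rule bidual_scale[OF G pull(1)[OF i \<tau>]])
    finally show ?thesis by simp
  qed
  have "((\<lambda>i. G (D i)) \<longlongrightarrow> 0) W"
  proof (rule tendstoI)
    fix \<epsilon> :: real assume \<epsilon>: "\<epsilon> > 0"
    define \<delta> where "\<delta> = \<epsilon> / (vnorm (bidual X) G + 1)"
    have \<delta>: "\<delta> > 0" "vnorm (bidual X) G * \<delta> < \<epsilon>"
      using \<epsilon> dual_norm_nonneg[OF dX G] by (simp_all add: \<delta>_def field_simps)
    show "eventually (\<lambda>i. dist (G (D i)) 0 < \<epsilon>) W"
      using c[OF \<delta>(1)] I
    proof eventually_elim
      case (elim i)
      have "vnorm (dual X) (D i) \<le> \<delta>"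
      proof (rule dual_norm_least[OF X])
        fix x assume x: "x \<in> vset X" "vnorm X x \<le> 1"
        have "norm (D i x) \<le> \<delta> * vnorm X x" using elim x by (simp add: D_def pullback_def)
        also have "\<dots> \<le> \<delta>" using x \<delta> by (intro mult_left_le) auto
        finally show "norm (D i x) \<le> \<delta>" .
      qed
      then have "vnorm (bidual X) G * vnorm (dual X) (D i) \<le> vnorm (bidual X) G * \<delta>"
        using dual_norm_nonneg[OF dX G] by (intro mult_left_mono)
      with dual_bound[OF dX G D(2)[OF elim(2)]] \<delta>(2) show ?case by simp
    qed
  qed
  from tendsto_add[OF this tendsto_mult[OF tendsto_const[of c] mass_tendsto[OF G]]]
  have "((\<lambda>i. G (D i) + c * G (pullback X (P i) \<tau>)) \<longlongrightarrow> c * mass G) W" by simp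
  moreover have "eventually (\<lambda>i. G (D i) + c * G (pullback X (P i) \<tau>) = G (pullback X (P i) \<phi>)) W"
    using I by eventually_elim (rule GD)
  ultimately show ?thesis unfolding \<open>p \<phi> = c\<close> by (rule Lim_transform_eventually)
qed

text \<open>
  Minus the projection onto the span of the atom, so that \<open>I + R\<close> removes the atom from \<open>G\<close>.
\<close>

definition R :: "(('v \<Rightarrow> 'k) \<Rightarrow> 'k) \<Rightarrow> ('v \<Rightarrow> 'k) \<Rightarrow> 'k" where
  "R G = (\<lambda>\<phi>. - mass G * p \<phi>)"

lemma R_bidual: "R G \<in> vset (bidual X)"
  unfolding R_def by (rule dual_scale[OF p_bidual])

lemma R_norm:
  assumes G: "G \<in> vset (bidual X)"
  shows "vnorm (bidual X) (R G) \<le> vnorm (bidual X) G"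
proof (rule dual_norm_least[OF dX])
  fix \<phi> assume \<phi>: "\<phi> \<in> vset (dual X)" "vnorm (dual X) \<phi> \<le> 1"
  have "norm (p \<phi> * mass G) \<le> vnorm (bidual X) G"
  proof (rule tendsto_upperbound[OF tendsto_norm[OF atom_tendsto[OF G \<phi>(1)]]])
    show "\<forall>\<^sub>F i in W. norm (G (pullback X (P i) \<phi>)) \<le> vnorm (bidual X) G"
      using I
    proof eventually_elim
      case (elim i)
      have "vnorm (bidual X) G * vnorm (dual X) \<phi> \<le> vnorm (bidual X) G"
        using \<phi>(2) dual_norm_nonneg[OF dX G] by (intro mult_left_le)
      with bidual_pull_bound(1)[OF G \<phi>(1) elim] show ?case by simp
    qed
  qed simp
  then show "norm (R G \<phi>) \<le> vnorm (bidual X) G" by (simp add: R_def norm_mult mult.commute)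
qed

text \<open>
  Since \<open>\<phi>\<close> is the sum of its pullbacks along \<open>P i\<close> and \<open>Q i\<close>, the functional \<open>G + R G\<close> is the limit
  of the restrictions of \<open>G\<close> to the complements of the shrinking sets, and pulling back along the
  contraction \<open>Q i\<close> does not increase norms.
\<close>

lemma I_plus_R_norm:
  assumes G: "G \<in> vset (bidual X)"
  shows "vnorm (bidual X) (vadd (bidual X) G (R G)) \<le> vnorm (bidual X) G"
proof (rule dual_norm_least[OF dX])
  fix \<phi> assume \<phi>: "\<phi> \<in> vset (dual X)" "vnorm (dual X) \<phi> \<le> 1"
  have split: "G \<phi> - G (pullback X (P i) \<phi>) = G (pullback X (Q i) \<phi>)" if i: "i \<in> I" for i
  proof -
    have "\<phi> x = pullback X (P i) \<phi> x + pullback X (Q i) \<phi> x" for x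
    proof (cases "x \<in> vset X")
      case True
      then have "P i x \<in> vset X" "Q i x \<in> vset X"
        using P[OF i] Q[OF i] by (auto simp: contraction_def bounded_linear_op_def)
      then have "\<phi> (vadd X (P i x) (Q i x)) = \<phi> (P i x) + \<phi> (Q i x)"
        using \<phi>(1) by (simp add: vset_dual)
      with True show ?thesis by (simp add: PQ[OF i] pullback_def)
    qed (use \<phi>(1) in \<open>simp add: vset_dual pullback_def\<close>)
    then have "\<phi> = (\<lambda>x. pullback X (P i) \<phi> x + pullback X (Q i) \<phi> x)" by blast
    then have "G \<phi> = G (\<lambda>x. pullback X (P i) \<phi> x + pullback X (Q i) \<phi> x)" by simp
    also have "\<dots> = G (pullback X (P i) \<phi>) + G (pullback X (Q i) \<phi>)"
      by (rule bidual_add[OF G pull[OF i \<phi>(1)]])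
    finally show ?thesis by simp
  qed
  have lim: "((\<lambda>i. G \<phi> - G (pullback X (P i) \<phi>)) \<longlongrightarrow> G \<phi> - p \<phi> * mass G) W"
    by (intro tendsto_diff tendsto_const atom_tendsto G \<phi>(1))
  have "norm (G \<phi> - p \<phi> * mass G) \<le> vnorm (bidual X) G"
  proof (rule tendsto_upperbound[OF tendsto_norm[OF lim]])
    show "\<forall>\<^sub>F i in W. norm (G \<phi> - G (pullback X (P i) \<phi>)) \<le> vnorm (bidual X) G"
      using I
    proof eventually_elim
      case (elim i)
      have "vnorm (bidual X) G * vnorm (dual X) \<phi> \<le> vnorm (bidual X) G"
        using \<phi>(2) dual_norm_nonneg[OF dX G] by (intro mult_left_le)
      with bidual_pull_bound(2)[OF G \<phi>(1) elim] show ?case by (simp add: split[OF elim])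
    qed
  qed simp
  then show "norm (vadd (bidual X) G (R G) \<phi>) \<le> vnorm (bidual X) G"
    by (simp add: R_def mult.commute)
qed

lemma mass_add:
  assumes "G \<in> vset (bidual X)" "H \<in> vset (bidual X)"
  shows "mass (\<lambda>\<phi>. G \<phi> + H \<phi>) = mass G + mass H"
  using assms by (intro mass_eq dual_add tendsto_add mass_tendsto)

lemma mass_scale:
  assumes "G \<in> vset (bidual X)"
  shows "mass (\<lambda>\<phi>. c * G \<phi>) = c * mass G"
  using assms by (intro mass_eq dual_scale tendsto_mult tendsto_const mass_tendsto)

lemma R_bounded: "bounded_linear_op (bidual X) (bidual X) R"
  unfolding bounded_linear_op_def
proof (intro conjI ballI allI)
  show "\<exists>C. \<forall>G\<in>vset (bidual X). vnorm (bidual X) (R G) \<le> C * vnorm (bidual X) G"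
    using R_norm by (intro exI[of _ 1]) simp
qed (simp_all add: R_bidual, simp_all add: R_def mass_add mass_scale algebra_simps)

lemma R_rank_one: "rank_one (bidual X) (bidual X) R"
  unfolding rank_one_def
proof (intro bexI conjI)
  show "p \<in> vset (bidual X)" by (rule p_bidual)
  show "p \<noteq> vzero (bidual X)" using p_\<tau> by (auto dest: fun_cong[of _ _ \<tau>])
  have "vscale (bidual X) c p \<in> R ` vset (bidual X)" for c
  proof (rule image_eqI)
    show "(\<lambda>\<phi>. - c * p \<phi>) \<in> vset (bidual X)" by (rule dual_scale[OF p_bidual])
    show "vscale (bidual X) c p = R (\<lambda>\<phi>. - c * p \<phi>)"
      unfolding R_def mass_scale[OF p_bidual] mass_p by simp
  qed
  moreover have "R G \<in> range (\<lambda>c. vscale (bidual X) c p)" for G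
    unfolding R_def by (rule image_eqI[of _ _ "- mass G"]) auto
  ultimately show "R ` vset (bidual X) = range (\<lambda>c. vscale (bidual X) c p)" by blast
qed

lemma R_norm_pos: "0 < op_norm (bidual X) (bidual X) R"
proof (rule ccontr)
  assume "\<not> 0 < op_norm (bidual X) (bidual X) R"
  then have "op_norm (bidual X) (bidual X) R * vnorm (bidual X) p \<le> 0"
    using dual_norm_nonneg[OF dX p_bidual] by (simp add: mult_nonpos_nonneg)
  with op_norm_bound[OF ddX ddX R_bounded p_bidual] have "vnorm (bidual X) (R p) \<le> 0" by simp
  then have "vnorm (bidual X) (R p) * vnorm (dual X) \<tau> \<le> 0"
    using dual_norm_nonneg[OF X \<tau>] by (simp add: mult_nonpos_nonneg)
  with dual_bound[OF dX R_bidual \<tau>, of p] have "norm (R p \<tau>) \<le> 0" by (rule order_trans)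
  then have "R p \<tau> = 0" by simp
  then show False by (simp add: R_def mass_p p_\<tau>)
qed

theorem bidual_not_daugavet: "\<not> daugavet_property (bidual X)"
proof
  assume "daugavet_property (bidual X)"
  then have "op_norm (bidual X) (bidual X) (\<lambda>G. vadd (bidual X) G (R G)) =
      1 + op_norm (bidual X) (bidual X) R"
    using R_bounded R_rank_one unfolding daugavet_property_def by blast
  moreover have "op_norm (bidual X) (bidual X) (\<lambda>G. vadd (bidual X) G (R G)) \<le> 1"
    using I_plus_R_norm by (intro op_norm_least[OF ddX]) (meson order_trans)
  ultimately show False using R_norm_pos by linarith
qed

end

section \<open>The norm along the orbits\<close>

lemma int_iterate_measure_preserving:
  assumes T: "invertible_mpt M T"
  shows "int_iterate M T k \<in> measurable M M" "distr M M (int_iterate M T k) = M"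
proof -
  let ?T' = "the_inv_into (space M) T"
  have bij: "bij_betw T (space M) (space M)" and meas: "T \<in> measurable M M" "?T' \<in> measurable M M"
    and pres: "\<And>A. A \<in> sets M \<Longrightarrow> emeasure M (T -` A \<inter> space M) = emeasure M A"
    using T by (auto simp: invertible_mpt_def)
  have dT: "distr M M T = M"
    using meas pres by (intro measure_eqI) (auto simp: emeasure_distr)
  have dT': "distr M M ?T' = M"
  proof -
    have "distr M M ?T' = distr (distr M M T) M ?T'" by (simp add: dT)
    also have "\<dots> = distr M M (?T' \<circ> T)" by (rule distr_distr[OF meas(2,1)])
    also have "\<dots> = distr M M (\<lambda>x. x)"
      using bij by (intro distr_cong) (auto simp: bij_betw_def the_inv_into_f_f)
    finally show ?thesis by (simp add: distr_id2)
  qed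
  have pow: "F ^^ n \<in> measurable M M \<and> distr M M (F ^^ n) = M"
    if F: "F \<in> measurable M M" "distr M M F = M" for F :: "'a \<Rightarrow> 'a" and n
  proof (induction n)
    case 0
    then show ?case by (simp add: distr_id2 id_def)
  next
    case (Suc n)
    then have m: "F ^^ n \<in> measurable M M" and d: "distr M M (F ^^ n) = M" by auto
    have "distr M M (F \<circ> (F ^^ n)) = distr (distr M M (F ^^ n)) M F"
      by (rule distr_distr[OF F(1) m, symmetric])
    then have "distr M M (F \<circ> (F ^^ n)) = M" by (simp add: d F(2))
    moreover have "F \<circ> (F ^^ n) \<in> measurable M M" using m F(1) by (rule measurable_comp)
    ultimately show ?case by (simp only: funpow.simps)
  qed
  show "int_iterate M T k \<in> measurable M M" "distr M M (int_iterate M T k) = M"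
    unfolding int_iterate_def using pow[OF meas(1) dT] pow[OF meas(2) dT'] by auto
qed

text \<open>
  Enumerating the integers turns the sum into a series of extended nonnegative reals, for which
  measurability and monotone convergence are at hand. The formula also covers divergent sums:
  \<^const>\<open>enn2real\<close> maps \<open>\<infinity>\<close> to the value \<open>0\<close> that \<^const>\<open>infsum\<close> has there.
\<close>

lemma infsum_int_eq_suminf:
  fixes g :: "int \<Rightarrow> real"
  assumes g: "\<And>k. 0 \<le> g k"
  shows "g summable_on UNIV \<longleftrightarrow> (\<Sum>n. ennreal (g (int_decode n))) \<noteq> top"
    and "infsum g UNIV = enn2real (\<Sum>n. ennreal (g (int_decode n)))"
proof -
  let ?h = "\<lambda>n. g (int_decode n)"
  have s: "g summable_on UNIV \<longleftrightarrow> summable ?h"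
    using summable_on_reindex_bij_betw[OF bij_int_decode, of g] summable_on_UNIV_nonneg_real_iff[of ?h] g
    by simp
  have i: "infsum g UNIV = infsum ?h UNIV"
    using infsum_reindex_bij_betw[OF bij_int_decode, of g] by simp
  show eq: "g summable_on UNIV \<longleftrightarrow> (\<Sum>n. ennreal (g (int_decode n))) \<noteq> top"
  proof
    assume "g summable_on UNIV"
    with s g show "(\<Sum>n. ennreal (g (int_decode n))) \<noteq> top"
      by (simp add: suminf_ennreal2)
  qed (use s g in \<open>simp add: summable_suminf_not_top\<close>)
  show "infsum g UNIV = enn2real (\<Sum>n. ennreal (g (int_decode n)))"
  proof (cases "g summable_on UNIV")
    case True
    then have "summable ?h" using s by simp
    then have "infsum ?h UNIV = suminf ?h"
      using g by (intro infsumI sums_nonneg_imp_has_sum) (auto simp: summable_sums)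
    with i g \<open>summable ?h\<close> show ?thesis by (simp add: suminf_ennreal2 suminf_nonneg)
  next
    case False
    with eq show ?thesis by (simp add: infsum_not_exists)
  qed
qed

lemma measurable_infsum_int:
  fixes g :: "int \<Rightarrow> 'a \<Rightarrow> real"
  assumes "\<And>k x. 0 \<le> g k x" and [measurable]: "\<And>k. g k \<in> borel_measurable M"
  shows "(\<lambda>x. \<Sum>\<^sub>\<infinity>k. g k x) \<in> borel_measurable M"
  unfolding infsum_int_eq_suminf(2)[OF assms(1)] by measurable

lemma sqrt_infsum_squares_le:
  fixes x :: "'a \<Rightarrow> real"
  assumes x: "\<And>k. 0 \<le> x k" and s: "x summable_on A"
  shows "(\<lambda>k. (x k)\<^sup>2) summable_on A" "sqrt (\<Sum>\<^sub>\<infinity>k\<in>A. (x k)\<^sup>2) \<le> infsum x A"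
proof -
  have le: "(\<Sum>k\<in>F. (x k)\<^sup>2) \<le> (infsum x A)\<^sup>2" if F: "finite F" "F \<subseteq> A" for F
  proof -
    have "sqrt (\<Sum>k\<in>F. (x k)\<^sup>2) \<le> (\<Sum>k\<in>F. x k)"
      using L2_set_le_sum[of F x] x by (simp add: L2_set_def)
    also have "\<dots> \<le> infsum x A" using s F x by (intro finite_sum_le_infsum) auto
    finally show ?thesis by (simp add: real_le_lsqrt sqrt_le_D)
  qed
  show "(\<lambda>k. (x k)\<^sup>2) summable_on A"
    using le by (intro nonneg_bdd_above_summable_on bdd_aboveI2) auto
  then have "(\<Sum>\<^sub>\<infinity>k\<in>A. (x k)\<^sup>2) \<le> (infsum x A)\<^sup>2"
    using le by (intro infsum_le_finite_sums)
  then show "sqrt (\<Sum>\<^sub>\<infinity>k\<in>A. (x k)\<^sup>2) \<le> infsum x A"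
    using x by (intro real_le_lsqrt infsum_nonneg)
qed

locale orbit_norm = prob_space M for M :: "'a measure" +
  fixes T :: "'a \<Rightarrow> 'a" and a :: "int \<Rightarrow> real"
  assumes T: "invertible_mpt M T" and a: "\<And>k. 0 < a k"
    and sqrt_a: "(\<lambda>k. sqrt (a k)) summable_on UNIV"
begin

abbreviation "S \<equiv> \<Sum>\<^sub>\<infinity>k. sqrt (a k)"

lemmas iter_measurable [measurable] = int_iterate_measure_preserving(1)[OF T]

lemma a_nonneg [simp]: "0 \<le> a k"
  using a[of k] by simp

lemma iter_0: "int_iterate M T 0 x = x"
  by (simp add: int_iterate_def)

lemma AE_iter: "AE x in M. P x \<Longrightarrow> AE x in M. \<forall>k. P (int_iterate M T k x)"
  using AE_distrD[OF iter_measurable] unfolding AE_all_countable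
  by (metis int_iterate_measure_preserving(2)[OF T])

lemma nn_integral_iter:
  assumes "h \<in> borel_measurable M"
  shows "(\<integral>\<^sup>+x. h (int_iterate M T k x) \<partial>M) = (\<integral>\<^sup>+x. h x \<partial>M)"
  using nn_integral_distr[OF iter_measurable, of h k] assms
  by (simp add: int_iterate_measure_preserving(2)[OF T])

context
  fixes f :: "'a \<Rightarrow> 'k::{real_normed_field, banach, second_countable_topology}"
  assumes f: "integrable M f"
begin

lemma [measurable]: "f \<in> borel_measurable M" using f by simp

lemma orbit_sum_nn_integral:
  "(\<integral>\<^sup>+x. (\<Sum>n. ennreal (sqrt (a (int_decode n)) * norm (f (int_iterate M T (int_decode n) x)))) \<partial>M) =
     ennreal (S * (LINT x|M. norm (f x)))"
proof -
  have fin: "(\<Sum>n. ennreal (sqrt (a (int_decode n)))) \<noteq> top"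
    by (rule infsum_int_eq_suminf(1)[THEN iffD1, OF _ sqrt_a]) simp
  have "(\<integral>\<^sup>+x. (\<Sum>n. ennreal (sqrt (a (int_decode n)) * norm (f (int_iterate M T (int_decode n) x)))) \<partial>M) =
     (\<Sum>n. \<integral>\<^sup>+x. ennreal (sqrt (a (int_decode n))) * ennreal (norm (f (int_iterate M T (int_decode n) x))) \<partial>M)"
    by (subst nn_integral_suminf) (auto simp: ennreal_mult)
  also have "\<dots> = (\<Sum>n. ennreal (sqrt (a (int_decode n))) * (\<integral>\<^sup>+x. ennreal (norm (f x)) \<partial>M))"
    by (simp add: nn_integral_cmult nn_integral_iter[of "\<lambda>x. ennreal (norm (f x))"])
  also have "\<dots> = (\<Sum>n. ennreal (sqrt (a (int_decode n)))) * (\<integral>\<^sup>+x. ennreal (norm (f x)) \<partial>M)"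
    by simp
  also have "(\<integral>\<^sup>+x. ennreal (norm (f x)) \<partial>M) = ennreal (LINT x|M. norm (f x))"
    using f by (intro nn_integral_eq_integral) auto
  also have "(\<Sum>n. ennreal (sqrt (a (int_decode n)))) = ennreal S"
    using fin by (subst infsum_int_eq_suminf(2)) (simp_all add: less_top)
  finally show ?thesis
    by (simp add: ennreal_mult' infsum_nonneg)
qed

text \<open>
  The orbit sum has the finite integral \<open>S\<close> times the \<open>L\<^sub>1\<close>-norm of \<open>f\<close>, because each iterate of \<open>T\<close>
  preserves the measure; hence it is finite almost everywhere.
\<close>

lemma orbit_summable:
  "AE x in M. (\<lambda>k. sqrt (a k) * norm (f (int_iterate M T k x))) summable_on UNIV"
proof -
  have "AE x in M. (\<Sum>n. ennreal (sqrt (a (int_decode n)) * norm (f (int_iterate M T (int_decode n) x)))) \<noteq> top"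
    unfolding infinity_ennreal_def[symmetric]
    by (rule nn_integral_PInf_AE) (auto simp: orbit_sum_nn_integral)
  then show ?thesis
    by eventually_elim (subst infsum_int_eq_suminf(1), auto)
qed

lemma orbit_sum_integral:
  "integrable M (\<lambda>x. \<Sum>\<^sub>\<infinity>k. sqrt (a k) * norm (f (int_iterate M T k x)))"
  "(LINT x|M. (\<Sum>\<^sub>\<infinity>k. sqrt (a k) * norm (f (int_iterate M T k x)))) = S * (LINT x|M. norm (f x))"
proof -
  let ?s = "\<lambda>x. \<Sum>\<^sub>\<infinity>k. sqrt (a k) * norm (f (int_iterate M T k x))"
  have nonneg: "0 \<le> sqrt (a k) * norm (f (int_iterate M T k x))" for k x
    using a[of k] by simp
  have pos: "0 \<le> ?s x" for x by (intro infsum_nonneg nonneg)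
  have [measurable]: "?s \<in> borel_measurable M"
    by (rule measurable_infsum_int[OF nonneg]) measurable
  have "AE x in M. ennreal (?s x) =
      (\<Sum>n. ennreal (sqrt (a (int_decode n)) * norm (f (int_iterate M T (int_decode n) x))))"
    using orbit_summable
    by eventually_elim (use infsum_int_eq_suminf[OF nonneg] in \<open>simp add: less_top\<close>)
  then have *: "(\<integral>\<^sup>+x. ennreal (?s x) \<partial>M) = ennreal (S * (LINT x|M. norm (f x)))"
    unfolding orbit_sum_nn_integral[symmetric] by (rule nn_integral_cong_AE)
  show "integrable M ?s"
    by (rule integrableI_nonneg) (auto simp: pos *)
  show "(LINT x|M. ?s x) = S * (LINT x|M. norm (f x))"
    by (subst integral_eq_nn_integral)
      (auto simp: pos * intro!: enn2real_ennreal mult_nonneg_nonneg infsum_nonneg)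
qed

lemma orbit_square_summable:
  "AE x in M. (\<lambda>k. a k * (norm (f (int_iterate M T k x)))\<^sup>2) summable_on UNIV \<and>
     sqrt (\<Sum>\<^sub>\<infinity>k. a k * (norm (f (int_iterate M T k x)))\<^sup>2) \<le>
       (\<Sum>\<^sub>\<infinity>k. sqrt (a k) * norm (f (int_iterate M T k x)))"
  using orbit_summable
proof eventually_elim
  case (elim x)
  have "0 \<le> sqrt (a k) * norm (f (int_iterate M T k x))" for k using a[of k] by simp
  from sqrt_infsum_squares_le[OF this elim] show ?case
    by (simp add: power_mult_distrib)
qed

lemma square_integrable:
  "integrable M (\<lambda>x. sqrt (\<Sum>\<^sub>\<infinity>k. a k * (norm (f (int_iterate M T k x)))\<^sup>2))"
proof (rule Bochner_Integration.integrable_bound[OF orbit_sum_integral(1)])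
  have pos: "0 \<le> a k * (norm (f (int_iterate M T k x)))\<^sup>2" for k x using a[of k] by simp
  have [measurable]: "(\<lambda>x. \<Sum>\<^sub>\<infinity>k. a k * (norm (f (int_iterate M T k x)))\<^sup>2) \<in> borel_measurable M"
    by (rule measurable_infsum_int[OF pos]) measurable
  show "(\<lambda>x. sqrt (\<Sum>\<^sub>\<infinity>k. a k * (norm (f (int_iterate M T k x)))\<^sup>2)) \<in> borel_measurable M"
    by measurable
  show "AE x in M. norm (sqrt (\<Sum>\<^sub>\<infinity>k. a k * (norm (f (int_iterate M T k x)))\<^sup>2)) \<le>
      norm (\<Sum>\<^sub>\<infinity>k. sqrt (a k) * norm (f (int_iterate M T k x)))"
    using orbit_square_summable
    by eventually_elim (auto simp: infsum_nonneg[OF pos] intro: order_trans)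
qed

text \<open>
  The \<open>\<ell>\<^sub>2\<close>-norm along an orbit is at most the \<open>\<ell>\<^sub>1\<close>-norm, and at least its term at \<open>k = 0\<close>; with the
  next lemma the new norm is equivalent to the \<open>L\<^sub>1\<close>-norm.
\<close>

lemma square_norm_le: "square_norm M T a f \<le> S * (LINT x|M. norm (f x))"
  unfolding square_norm_def orbit_sum_integral(2)[symmetric]
  using orbit_square_summable
  by (intro integral_mono_AE square_integrable orbit_sum_integral(1)) auto

lemma square_norm_ge: "sqrt (a 0) * (LINT x|M. norm (f x)) \<le> square_norm M T a f"
proof -
  have "AE x in M. sqrt (a 0) * norm (f x) \<le> sqrt (\<Sum>\<^sub>\<infinity>k. a k * (norm (f (int_iterate M T k x)))\<^sup>2)"
    using orbit_square_summable
  proof eventually_elim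
    case (elim x)
    then have "(\<Sum>k\<in>{0}. a k * (norm (f (int_iterate M T k x)))\<^sup>2) \<le>
        (\<Sum>\<^sub>\<infinity>k. a k * (norm (f (int_iterate M T k x)))\<^sup>2)"
      by (intro finite_sum_le_infsum) auto
    then have "a 0 * (norm (f x))\<^sup>2 \<le> (\<Sum>\<^sub>\<infinity>k. a k * (norm (f (int_iterate M T k x)))\<^sup>2)"
      by (simp add: iter_0)
    then have "sqrt (a 0 * (norm (f x))\<^sup>2) \<le> sqrt (\<Sum>\<^sub>\<infinity>k. a k * (norm (f (int_iterate M T k x)))\<^sup>2)"
      by (rule real_sqrt_le_mono)
    then show ?case by (simp add: real_sqrt_mult)
  qed
  then have "(LINT x|M. sqrt (a 0) * norm (f x)) \<le> square_norm M T a f"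
    unfolding square_norm_def using f by (intro integral_mono_AE square_integrable) auto
  then show ?thesis by simp
qed

end

text \<open>
  The property of the new norm on which everything rests: it is a lattice norm. In particular
  multiplication by an indicator is a contraction.
\<close>

lemma square_norm_mono:
  fixes f g :: "'a \<Rightarrow> 'k::{real_normed_field, banach, second_countable_topology}"
  assumes f: "integrable M f" and g: "integrable M g" and le: "AE x in M. norm (f x) \<le> norm (g x)"
  shows "square_norm M T a f \<le> square_norm M T a g"
  unfolding square_norm_def
proof (intro integral_mono_AE square_integrable f g)
  show "AE x in M. sqrt (\<Sum>\<^sub>\<infinity>k. a k * (norm (f (int_iterate M T k x)))\<^sup>2) \<le>
      sqrt (\<Sum>\<^sub>\<infinity>k. a k * (norm (g (int_iterate M T k x)))\<^sup>2)"
    using orbit_square_summable[OF f] orbit_square_summable[OF g] AE_iter[OF le]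
  proof eventually_elim
    case (elim x)
    then have "(\<Sum>\<^sub>\<infinity>k. a k * (norm (f (int_iterate M T k x)))\<^sup>2) \<le>
        (\<Sum>\<^sub>\<infinity>k. a k * (norm (g (int_iterate M T k x)))\<^sup>2)"
      by (intro infsum_mono mult_left_mono power_mono) auto
    then show ?case by (rule real_sqrt_le_mono)
  qed
qed

lemma square_norm_scale:
  fixes f :: "'a \<Rightarrow> 'k::{real_normed_field, banach, second_countable_topology}"
  shows "square_norm M T a (\<lambda>x. c * f x) = norm c * square_norm M T a f"
proof -
  have "(\<lambda>k. a k * (norm (c * f (int_iterate M T k x)))\<^sup>2) =
      (\<lambda>k. (norm c)\<^sup>2 * (a k * (norm (f (int_iterate M T k x)))\<^sup>2))" for x
    by (simp add: norm_mult power_mult_distrib algebra_simps)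
  then show ?thesis
    by (simp add: square_norm_def infsum_cmult_right' real_sqrt_mult)
qed

lemma square_norm_nonneg: "0 \<le> square_norm M T a f"
  unfolding square_norm_def
  by (intro integral_nonneg_AE) (auto intro!: infsum_nonneg)

end

section \<open>Functionals on integrable functions have bounded densities\<close>

text \<open>
  The Radon-Nikodym theorem for a real set function dominated by \<open>C\<close> times the measure: adding
  \<open>C\<close> times the measure makes it nonnegative, and the domination yields both countable additivity
  and absolute continuity.
\<close>

lemma (in finite_measure) bounded_additive_density:
  fixes m :: "'a set \<Rightarrow> real"
  assumes add: "\<And>A B. A \<in> sets M \<Longrightarrow> B \<in> sets M \<Longrightarrow> A \<inter> B = {} \<Longrightarrow> m (A \<union> B) = m A + m B"
    and bound: "\<And>A. A \<in> sets M \<Longrightarrow> \<bar>m A\<bar> \<le> C * measure M A"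
  shows "\<exists>g. integrable M g \<and> (\<forall>A\<in>sets M. m A = (LINT x|M. indicator A x * g x))"
proof -
  define n where "n A = m A + C * measure M A" for A
  have n: "0 \<le> n A" "n A \<le> 2 * C * measure M A" if "A \<in> sets M" for A
    using bound[OF that] by (auto simp: n_def)
  have m_empty: "m {} = 0" using bound[of "{}"] by simp
  define N where "N = measure_of (space M) (sets M) (\<lambda>A. ennreal (n A))"
  have sets_N [simp]: "sets N = sets M" and space_N [simp]: "space N = space M"
    by (simp_all add: N_def)
  have N: "emeasure N A = ennreal (n A)" if "A \<in> sets M" for A
    unfolding N_def
  proof (rule emeasure_measure_of_sigma[OF sets.sigma_algebra_axioms _ _ that])
    show pos: "positive (sets M) (\<lambda>A. ennreal (n A))"
      by (simp add: positive_def n_def m_empty)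
    show "countably_additive (sets M) (\<lambda>A. ennreal (n A))"
    proof (rule sets.empty_continuous_imp_countably_additive[OF pos])
      show "additive (sets M) (\<lambda>A. ennreal (n A))"
        unfolding additive_def
      proof (intro ballI impI)
        fix A B assume *: "A \<in> sets M" "B \<in> sets M" "A \<inter> B = {}"
        then have "n (A \<union> B) = n A + n B"
          using add finite_measure_Union[of A B] by (simp add: n_def algebra_simps)
        with n * show "ennreal (n (A \<union> B)) = ennreal (n A) + ennreal (n B)" by simp
      qed
      fix A :: "nat \<Rightarrow> 'a set"
      assume A: "range A \<subseteq> sets M" "decseq A" "(\<Inter>i. A i) = {}"
      have "(\<lambda>i. measure M (A i)) \<longlonglongrightarrow> 0"
        using finite_Lim_measure_decseq[OF A(1,2)] A(3) by simp
      from tendsto_mult[OF tendsto_const[of "2 * C"] this]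
      have lim: "(\<lambda>i. 2 * C * measure M (A i)) \<longlonglongrightarrow> 0" by simp
      have "(\<lambda>i. n (A i)) \<longlonglongrightarrow> 0"
        by (rule tendsto_sandwich[OF _ _ tendsto_const lim]) (use A(1) n in auto)
      then show "(\<lambda>i. ennreal (n (A i))) \<longlonglongrightarrow> 0"
        using tendsto_ennrealI by fastforce
    qed simp
  qed
  have "finite_measure N" by (rule finite_measureI) (simp add: N)
  moreover have "absolutely_continuous M N"
    unfolding absolutely_continuous_def
  proof
    fix A assume A: "A \<in> null_sets M"
    then have "A \<in> sets M" "measure M A = 0" by (auto simp: measure_eq_0_null_sets)
    then have "n A = 0" using n[of A] by simp
    with \<open>A \<in> sets M\<close> show "A \<in> null_sets N" by (simp add: null_sets_def N)
  qed
  ultimately obtain h where h [measurable]: "h \<in> borel_measurable M" and dens: "density M h = N"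
    using Radon_Nikodym_finite_measure[of N] by auto
  have int: "(\<integral>\<^sup>+x. h x * indicator A x \<partial>M) = ennreal (n A)" if "A \<in> sets M" for A
    using emeasure_density[OF h that] that by (simp add: dens N)
  have top: "(\<integral>\<^sup>+x. h x \<partial>M) = ennreal (n (space M))"
    using int[of "space M"] by (simp cong: nn_integral_cong)
  have "AE x in M. h x \<noteq> \<infinity>"
    by (rule nn_integral_PInf_AE) (simp_all add: top)
  then have fin: "AE x in M. ennreal (enn2real (h x)) = h x"
    by eventually_elim (simp add: less_top)
  have h_int: "integrable M (\<lambda>x. enn2real (h x))"
  proof (rule integrableI_nonneg)
    have "(\<integral>\<^sup>+x. ennreal (enn2real (h x)) \<partial>M) = (\<integral>\<^sup>+x. h x \<partial>M)"
      using fin by (intro nn_integral_cong_AE) auto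
    then show "(\<integral>\<^sup>+x. ennreal (enn2real (h x)) \<partial>M) < \<infinity>" by (simp add: top)
  qed auto
  have "m A = (LINT x|M. indicator A x * (enn2real (h x) - C))" if A: "A \<in> sets M" for A
  proof -
    have i: "integrable M (\<lambda>x. indicator A x * enn2real (h x))"
      using integrable_mult_indicator[OF A h_int] by simp
    have "(\<integral>\<^sup>+x. ennreal (indicator A x * enn2real (h x)) \<partial>M) = (\<integral>\<^sup>+x. h x * indicator A x \<partial>M)"
      using fin by (intro nn_integral_cong_AE) (auto split: split_indicator)
    then have "(LINT x|M. indicator A x * enn2real (h x)) = n A"
      using A n(1)[OF A] by (subst integral_eq_nn_integral) (auto simp: int)
    moreover have "(LINT x|M. indicator A x * C) = C * measure M A" using A by simp
    moreover have "integrable M (\<lambda>x. indicator A x * C)"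
      using integrable_mult_indicator[OF A, of "\<lambda>x. C"] by simp
    ultimately show ?thesis
      using i by (simp add: right_diff_distrib n_def del: integral_mult_left_zero integral_mult_left)
  qed
  moreover have "integrable M (\<lambda>x. enn2real (h x) - C)" using h_int by simp
  ultimately show ?thesis by blast
qed

text \<open>
  The dual of \<open>L\<^sub>1\<close> is \<open>L\<^sub>\<infinity>\<close>, for real and complex scalars at once: the coordinates of the values on
  indicator functions have densities \<open>\<gamma> b\<close>, which are assembled to \<open>g0\<close>. All averages of \<open>g0\<close> lie
  in the ball of radius \<open>K\<close>, hence so does almost every value of \<open>g0\<close>.
\<close>

lemma (in finite_measure) bounded_functional_density:
  fixes \<Phi> :: "('a \<Rightarrow> 'k) \<Rightarrow> 'k::{real_normed_field, euclidean_space}"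
  assumes add: "\<And>f g. integrable M f \<Longrightarrow> integrable M g \<Longrightarrow> \<Phi> (\<lambda>x. f x + g x) = \<Phi> f + \<Phi> g"
    and scale: "\<And>c f. integrable M f \<Longrightarrow> \<Phi> (\<lambda>x. c * f x) = c * \<Phi> f"
    and bound: "\<And>f. integrable M f \<Longrightarrow> norm (\<Phi> f) \<le> K * (LINT x|M. norm (f x))"
    and K: "0 \<le> K"
  shows "\<exists>g\<in>borel_measurable M. (\<forall>x. norm (g x) \<le> K) \<and>
    (\<forall>f. integrable M f \<longrightarrow> \<Phi> f = (LINT x|M. g x * f x))"
proof -
  let ?\<chi> = "\<lambda>A x. indicator A x :: 'k"
  have ind: "integrable M (?\<chi> A)" if "A \<in> sets M" for A
  proof -
    have "integrable M (\<lambda>x. indicat_real A x *\<^sub>R (1::'k))"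
      using that by (intro integrable_scaleR_left) (simp add: emeasure_eq_measure)
    moreover have "(\<lambda>x. indicat_real A x *\<^sub>R (1::'k)) = ?\<chi> A"
      by (auto split: split_indicator)
    ultimately show ?thesis by simp
  qed
  have \<chi>_bound: "norm (\<Phi> (?\<chi> A)) \<le> K * measure M A" if A: "A \<in> sets M" for A
  proof -
    have "norm (\<Phi> (?\<chi> A)) \<le> K * (LINT x|M. norm (?\<chi> A x))" by (rule bound[OF ind[OF A]])
    also have "(LINT x|M. norm (?\<chi> A x)) = (LINT x|M. indicator A x)"
      by (intro Bochner_Integration.integral_cong) (auto split: split_indicator)
    finally show ?thesis using A by simp
  qed
  have "\<exists>g. integrable M g \<and> (\<forall>A\<in>sets M. \<Phi> (?\<chi> A) \<bullet> b = (LINT x|M. indicator A x * g x))"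
    if b: "b \<in> Basis" for b :: 'k
  proof (rule bounded_additive_density)
    fix A B assume AB: "A \<in> sets M" "B \<in> sets M" "A \<inter> B = {}"
    then have "?\<chi> (A \<union> B) = (\<lambda>x. ?\<chi> A x + ?\<chi> B x)"
      by (auto simp: fun_eq_iff indicator_def)
    with AB ind add show "\<Phi> (?\<chi> (A \<union> B)) \<bullet> b = \<Phi> (?\<chi> A) \<bullet> b + \<Phi> (?\<chi> B) \<bullet> b"
      by (simp add: inner_add_left)
  next
    fix A assume "A \<in> sets M"
    with \<chi>_bound[of A] Basis_le_norm[OF b, of "\<Phi> (?\<chi> A)"]
    show "\<bar>\<Phi> (?\<chi> A) \<bullet> b\<bar> \<le> K * measure M A" by linarith
  qed
  then obtain \<gamma> where \<gamma>: "\<And>b. b \<in> Basis \<Longrightarrow> integrable M (\<gamma> b :: 'a \<Rightarrow> real)"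
    "\<And>b A. b \<in> Basis \<Longrightarrow> A \<in> sets M \<Longrightarrow> \<Phi> (?\<chi> A) \<bullet> b = (LINT x|M. indicator A x * \<gamma> b x)"
    by metis
  define g0 where "g0 x = (\<Sum>b\<in>Basis. \<gamma> b x *\<^sub>R b)" for x
  have g0_int: "integrable M g0"
    unfolding g0_def using \<gamma>(1) by (intro Bochner_Integration.integrable_sum integrable_scaleR_left) auto
  have g0: "(LINT x|M. indicator A x *\<^sub>R g0 x) = \<Phi> (?\<chi> A)" if A: "A \<in> sets M" for A
  proof -
    have i: "integrable M (\<lambda>x. (indicator A x * \<gamma> b x) *\<^sub>R b)" if "b \<in> Basis" for b :: 'k
      using integrable_mult_indicator[OF A \<gamma>(1)[OF that]] by (simp add: integrable_scaleR_left)
    have "(LINT x|M. indicator A x *\<^sub>R g0 x) = (LINT x|M. (\<Sum>b\<in>Basis. (indicator A x * \<gamma> b x) *\<^sub>R b))"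
      by (simp add: g0_def scaleR_sum_right)
    also have "\<dots> = (\<Sum>b\<in>Basis. (LINT x|M. (indicator A x * \<gamma> b x) *\<^sub>R b))"
      using i by (rule Bochner_Integration.integral_sum)
    also have "\<dots> = (\<Sum>b\<in>Basis. (\<Phi> (?\<chi> A) \<bullet> b) *\<^sub>R b)"
      using integrable_mult_indicator[OF A \<gamma>(1)] \<gamma>(2)[OF _ A]
      by (intro sum.cong) (auto simp: integral_scaleR_left)
    finally show ?thesis by (simp add: euclidean_representation)
  qed
  have g0_AE: "AE x in M. g0 x \<in> cball 0 K"
  proof (rule averaging_theorem[OF g0_int closed_cball])
    fix A assume A: "A \<in> sets M" "measure M A > 0"
    with \<chi>_bound[OF A(1)] show "(1 / measure M A) *\<^sub>R set_lebesgue_integral M A g0 \<in> cball 0 K"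
      by (simp add: set_lebesgue_integral_def g0 field_simps)
  qed
  define g where "g x = (if norm (g0 x) \<le> K then g0 x else 0)" for x
  have g0_meas [measurable]: "g0 \<in> borel_measurable M" using g0_int by simp
  have g_meas [measurable]: "g \<in> borel_measurable M" unfolding g_def by measurable
  have g_bound: "norm (g x) \<le> K" for x using K by (simp add: g_def)
  have g_eq: "AE x in M. g x = g0 x" using g0_AE by eventually_elim (simp add: g_def)
  have gf_int: "integrable M (\<lambda>x. g x * f x)" if f: "integrable M f" for f
  proof (rule Bochner_Integration.integrable_bound)
    show "integrable M (\<lambda>x. K * norm (f x))" using f by simp
    have [measurable]: "f \<in> borel_measurable M" using f by simp
    show "(\<lambda>x. g x * f x) \<in> borel_measurable M" by measurable
    show "AE x in M. norm (g x * f x) \<le> norm (K * norm (f x))"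
      using g_bound K by (auto simp: norm_mult intro!: AE_I2 mult_right_mono)
  qed
  \<comment> \<open>The error \<open>\<Psi>\<close> is additive, continuous for the \<open>L\<^sub>1\<close>-norm, and vanishes on indicators.\<close>
  define \<Psi> where "\<Psi> f = \<Phi> f - (LINT x|M. g x * f x)" for f
  have \<Psi>_add: "\<Psi> (\<lambda>x. f x + h x) = \<Psi> f + \<Psi> h" if "integrable M f" "integrable M h" for f h
    using that gf_int[OF that(1)] gf_int[OF that(2)] by (simp add: \<Psi>_def add distrib_left)
  have \<Psi>_bound: "norm (\<Psi> f) \<le> 2 * K * (LINT x|M. norm (f x))" if f: "integrable M f" for f
  proof -
    have "norm (LINT x|M. g x * f x) \<le> (LINT x|M. K * norm (f x))"
    proof (rule order_trans[OF integral_norm_bound], rule integral_mono)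
      show "integrable M (\<lambda>x. norm (g x * f x))" by (rule integrable_norm[OF gf_int[OF f]])
    qed (use f g_bound in \<open>auto simp: norm_mult intro: mult_right_mono\<close>)
    with bound[OF f] norm_triangle_ineq4[of "\<Phi> f" "LINT x|M. g x * f x"] show ?thesis
      by (simp add: \<Psi>_def)
  qed
  have "\<Psi> f = 0" if "integrable M f" for f
    using that
  proof (induct rule: integrable_induct)
    case (base A c)
    have "\<Phi> (\<lambda>x. indicator A x *\<^sub>R c) = \<Phi> (\<lambda>x. c * ?\<chi> A x)"
      by (rule arg_cong[of _ _ \<Phi>]) (auto split: split_indicator)
    also have "\<dots> = c * (LINT x|M. indicator A x *\<^sub>R g0 x)"
      by (simp add: scale ind[OF base(1)] g0[OF base(1)])
    also have "(LINT x|M. indicator A x *\<^sub>R g0 x) = (LINT x|M. indicator A x *\<^sub>R g x)"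
      using g_eq base(1) by (intro integral_cong_AE) auto
    also have "c * (LINT x|M. indicator A x *\<^sub>R g x) = (LINT x|M. c * (indicator A x *\<^sub>R g x))"
      by (rule integral_mult_right_zero[symmetric])
    also have "\<dots> = (LINT x|M. g x * (indicator A x *\<^sub>R c))"
      by (intro Bochner_Integration.integral_cong) (auto simp: mult.commute)
    finally show ?case by (simp add: \<Psi>_def)
  next
    case (add f h)
    then show ?case by (simp add: \<Psi>_add)
  next
    case (lim f s)
    have d: "integrable M (\<lambda>x. f x - s i x)" for i using lim by simp
    have "(\<lambda>i. LINT x|M. norm (f x - s i x)) \<longlonglongrightarrow> (LINT x|M. 0 :: real)"
    proof (rule integral_dominated_convergence)
      show "integrable M (\<lambda>x. 3 * norm (f x))" using lim by simp
      show "(\<lambda>x. norm (f x - s i x)) \<in> borel_measurable M" for i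
        by (rule borel_measurable_integrable[OF integrable_norm[OF d]])
      show "AE x in M. (\<lambda>i. norm (f x - s i x)) \<longlonglongrightarrow> 0"
      proof (rule AE_I2)
        fix x assume "x \<in> space M"
        from tendsto_norm[OF tendsto_diff[OF tendsto_const[of "f x"] lim(3)[OF this]]]
        show "(\<lambda>i. norm (f x - s i x)) \<longlonglongrightarrow> 0" by simp
      qed
      show "AE x in M. norm (norm (f x - s i x)) \<le> 3 * norm (f x)" for i
      proof (rule AE_I2)
        fix x assume "x \<in> space M"
        from lim(4)[OF this, of i] norm_triangle_ineq4[of "f x" "s i x"]
        show "norm (norm (f x - s i x)) \<le> 3 * norm (f x)" by simp
      qed
    qed simp
    from tendsto_mult[OF tendsto_const[of "2 * K"] this]
    have "(\<lambda>i. 2 * K * (LINT x|M. norm (f x - s i x))) \<longlonglongrightarrow> 0" by simp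
    moreover have "norm (\<Psi> f) \<le> 2 * K * (LINT x|M. norm (f x - s i x))" for i
    proof -
      have "\<Psi> f = \<Psi> (\<lambda>x. f x - s i x) + \<Psi> (s i)"
        using \<Psi>_add[OF d[of i] lim(1)[of i]] by simp
      with lim(2)[of i] \<Psi>_bound[OF d[of i]] show ?thesis by simp
    qed
    ultimately have "norm (\<Psi> f) \<le> 0" by (intro LIMSEQ_le_const) auto
    then show ?case by simp
  qed
  then show ?thesis
    using g_meas g_bound by (intro bexI[of _ g]) (auto simp: \<Psi>_def)
qed

section \<open>Bands of the renormed space\<close>

text \<open>
  An ultrafilter \<open>W\<close> on sets that contains, for every measurable member \<open>B\<close> of \<open>U\<close>, the collection of
  the smaller measurable members of \<open>U\<close>. Limits along \<open>W\<close> are limits as the sets shrink along \<open>U\<close>.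
\<close>

lemma shrinking_sets:
  assumes U: "ultra U" and ae: "U \<le> ae_filter M"
  obtains W where "ultra W"
    and "eventually (\<lambda>A. A \<in> sets M \<and> eventually (\<lambda>x. x \<in> A) U) W"
    and "\<And>B. B \<in> sets M \<Longrightarrow> eventually (\<lambda>x. x \<in> B) U \<Longrightarrow> eventually (\<lambda>A. A \<subseteq> B) W"
proof -
  define \<B> where "\<B> = {B \<in> sets M. eventually (\<lambda>x. x \<in> B) U}"
  define F where "F = (\<Sqinter>B\<in>\<B>. principal {A \<in> \<B>. A \<subseteq> B})"
  have "space M \<in> \<B>"
    using filter_leD[OF ae AE_space] by (simp add: \<B>_def)
  moreover have "\<exists>k\<in>\<B>. principal {A \<in> \<B>. A \<subseteq> k} \<le>
      principal {A \<in> \<B>. A \<subseteq> i} \<sqinter> principal {A \<in> \<B>. A \<subseteq> j}" if "i \<in> \<B>" "j \<in> \<B>" for i j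
    using that by (intro bexI[of _ "i \<inter> j"]) (auto simp: \<B>_def eventually_conj)
  ultimately have "F \<noteq> bot"
    unfolding F_def by (subst INF_filter_bot_base) (auto simp: principal_eq_bot_iff)
  then obtain W where W: "W \<le> F" "ultra W" by (rule ultra_below)
  have *: "eventually (\<lambda>A. A \<in> \<B> \<and> A \<subseteq> B) W" if "B \<in> \<B>" for B
    by (rule filter_leD[OF W(1)], unfold F_def, rule eventually_INF1[OF that])
      (auto simp: eventually_principal)
  show thesis
  proof (rule that[OF W(2)])
    show "eventually (\<lambda>A. A \<in> sets M \<and> eventually (\<lambda>x. x \<in> A) U) W"
      using *[OF \<open>space M \<in> \<B>\<close>] by (rule eventually_mono) (simp add: \<B>_def)
    show "eventually (\<lambda>A. A \<subseteq> B) W" if "B \<in> sets M" "eventually (\<lambda>x. x \<in> B) U" for B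
      using *[of B] that by (auto simp: \<B>_def elim: eventually_mono)
  qed
qed

context orbit_norm
begin

abbreviation L :: "('k::{real_normed_field, euclidean_space}, ('a \<Rightarrow> 'k) set) nspace" where
  "L \<equiv> renormed_L1 M T a"

definition cls :: "('a \<Rightarrow> 'k::{real_normed_field, euclidean_space}) \<Rightarrow> ('a \<Rightarrow> 'k) set" where
  "cls f = ae_rel M `` {f}"

definition rep :: "('a \<Rightarrow> 'k::{real_normed_field, euclidean_space}) set \<Rightarrow> 'a \<Rightarrow> 'k" where
  "rep x = (SOME f. f \<in> x)"

lemma mem_cls: "g \<in> cls f \<longleftrightarrow> integrable M f \<and> integrable M g \<and> (AE x in M. f x = g x)"
  by (simp add: cls_def ae_rel_def)

lemma cls_eqI:
  assumes "integrable M f" "integrable M g" "AE x in M. f x = g x"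
  shows "cls f = cls g"
proof -
  have "(AE x in M. f x = h x) \<longleftrightarrow> (AE x in M. g x = h x)" for h
    using assms(3) by (auto elim!: eventually_elim2)
  with assms show ?thesis by (auto simp: mem_cls)
qed

lemma rep_cls:
  assumes "integrable M f"
  shows "integrable M (rep (cls f))" "AE x in M. rep (cls f) x = f x" "cls (rep (cls f)) = cls f"
proof -
  have "f \<in> cls f" using assms by (simp add: mem_cls)
  then have "rep (cls f) \<in> cls f" unfolding rep_def by (rule someI[of "\<lambda>g. g \<in> cls f"])
  then show *: "integrable M (rep (cls f))" "AE x in M. rep (cls f) x = f x"
    by (auto simp: mem_cls elim: eventually_mono)
  with assms show "cls (rep (cls f)) = cls f" by (intro cls_eqI)
qed

lemma vset_L: "vset L = cls ` {f. integrable M f}"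
  by (auto simp: renormed_L1_def quotient_def cls_def)

lemma vadd_L:
  assumes f: "integrable M f" and g: "integrable M g"
  shows "vadd L (cls f) (cls g) = cls (\<lambda>x. f x + g x)"
proof -
  have "cls (\<lambda>x. f' x + g' x) = cls (\<lambda>x. f x + g x)" if "f' \<in> cls f" "g' \<in> cls g" for f' g'
  proof (rule cls_eqI)
    from that have "AE x in M. f x = f' x" "AE x in M. g x = g' x" by (auto simp: mem_cls)
    then show "AE x in M. f' x + g' x = f x + g x" by eventually_elim simp
  qed (use f g that in \<open>auto simp: mem_cls\<close>)
  then have "(\<Union>f'\<in>cls f. \<Union>g'\<in>cls g. cls (\<lambda>x. f' x + g' x)) = (\<Union>f'\<in>cls f. \<Union>g'\<in>cls g. cls (\<lambda>x. f x + g x))"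
    by (intro SUP_cong refl)
  moreover have "cls f \<noteq> {}" "cls g \<noteq> {}" using f g mem_cls by blast+
  ultimately show ?thesis by (simp add: renormed_L1_def cls_def)
qed

lemma vscale_L:
  assumes f: "integrable M f"
  shows "vscale L c (cls f) = cls (\<lambda>x. c * f x)"
proof -
  have "cls (\<lambda>x. c * f' x) = cls (\<lambda>x. c * f x)" if "f' \<in> cls f" for f'
  proof (rule cls_eqI)
    from that have "AE x in M. f x = f' x" by (auto simp: mem_cls)
    then show "AE x in M. c * f' x = c * f x" by eventually_elim simp
  qed (use f that in \<open>auto simp: mem_cls\<close>)
  then have "(\<Union>f'\<in>cls f. cls (\<lambda>x. c * f' x)) = (\<Union>f'\<in>cls f. cls (\<lambda>x. c * f x))"
    by (intro SUP_cong refl)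
  moreover have "cls f \<noteq> {}" using f mem_cls by blast
  ultimately show ?thesis by (simp add: renormed_L1_def cls_def)
qed

lemma vnorm_L:
  assumes f: "integrable M f"
  shows "vnorm L (cls f) = square_norm M T a f"
proof -
  have "square_norm M T a g = square_norm M T a f" if "g \<in> cls f" for g
    using that by (intro antisym square_norm_mono) (auto simp: mem_cls)
  then have "square_norm M T a ` cls f = (\<lambda>g. square_norm M T a f) ` cls f"
    by (intro image_cong refl)
  also have "\<dots> = {square_norm M T a f}"
    using f by (intro image_constant[of f]) (simp add: mem_cls)
  finally have "square_norm M T a ` cls f = {square_norm M T a f}" .
  then show ?thesis by (simp add: renormed_L1_def)
qed

lemma homogeneous_L: "homogeneous (L :: ('k::{real_normed_field, euclidean_space}, ('a \<Rightarrow> 'k) set) nspace)"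
proof -
  have "cls (\<lambda>x. 0 :: 'k) \<in> vset L" by (auto simp: vset_L)
  then show ?thesis
    unfolding homogeneous_def
    by (auto simp: vset_L vnorm_L vscale_L square_norm_nonneg square_norm_scale)
qed

definition band :: "'a set \<Rightarrow> ('a \<Rightarrow> 'k::{real_normed_field, euclidean_space}) set \<Rightarrow> ('a \<Rightarrow> 'k) set" where
  "band A x = cls (\<lambda>\<omega>. indicat_real A \<omega> *\<^sub>R rep x \<omega>)"

lemma band_cls:
  assumes A: "A \<in> sets M" and f: "integrable M f"
  shows "band A (cls f) = cls (\<lambda>\<omega>. indicat_real A \<omega> *\<^sub>R f \<omega>)"
  unfolding band_def
proof (rule cls_eqI)
  show "AE \<omega> in M. indicat_real A \<omega> *\<^sub>R rep (cls f) \<omega> = indicat_real A \<omega> *\<^sub>R f \<omega>"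
    using rep_cls(2)[OF f] by eventually_elim simp
qed (rule integrable_mult_indicator[OF A] rep_cls(1)[OF f] f)+

lemma contraction_band:
  assumes A: "A \<in> sets M"
  shows "contraction (L :: ('k::{real_normed_field, euclidean_space}, ('a \<Rightarrow> 'k) set) nspace) (band A)"
proof -
  have i: "integrable M (\<lambda>\<omega>. indicat_real A \<omega> *\<^sub>R f \<omega>)" if "integrable M f" for f :: "'a \<Rightarrow> 'k"
    using A that by (rule integrable_mult_indicator)
  have le: "vnorm L (band A x) \<le> vnorm L x" if "x \<in> vset L" for x :: "('a \<Rightarrow> 'k) set"
  proof -
    from that obtain f where f: "integrable M f" and x: "x = cls f" by (auto simp: vset_L)
    have "square_norm M T a (\<lambda>\<omega>. indicat_real A \<omega> *\<^sub>R f \<omega>) \<le> square_norm M T a f"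
      by (intro square_norm_mono i f AE_I2) (auto split: split_indicator)
    then show ?thesis by (simp add: x band_cls[OF A f] vnorm_L i f)
  qed
  then have bd: "\<exists>C. \<forall>x\<in>vset L. vnorm L (band A x) \<le> C * vnorm L (x :: ('a \<Rightarrow> 'k) set)"
    by (intro exI[of _ 1]) simp
  have "band A x \<in> vset L" if "x \<in> vset L" for x :: "('a \<Rightarrow> 'k) set"
    using that i by (auto simp: vset_L band_cls[OF A])
  moreover have "band A (vadd L x y) = vadd L (band A x) (band A y)"
    if "x \<in> vset L" "y \<in> vset L" for x y :: "('a \<Rightarrow> 'k) set"
  proof -
    from that obtain f g where "integrable M f" "x = cls f" "integrable M g" "y = cls g"
      by (auto simp: vset_L)
    then show ?thesis by (simp add: band_cls[OF A] vadd_L i scaleR_add_right)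
  qed
  moreover have "band A (vscale L c x) = vscale L c (band A x)"
    if "x \<in> vset L" for c and x :: "('a \<Rightarrow> 'k) set"
  proof -
    from that obtain f where "integrable M f" "x = cls f" by (auto simp: vset_L)
    then show ?thesis by (simp add: band_cls[OF A] vscale_L i)
  qed
  ultimately show ?thesis
    unfolding contraction_def bounded_linear_op_def using le bd by blast
qed

definition \<tau> :: "('a \<Rightarrow> 'k::{real_normed_field, euclidean_space}) set \<Rightarrow> 'k" where
  "\<tau> x = (if x \<in> vset L then LINT \<omega>|M. rep x \<omega> else 0)"

lemma \<tau>_cls:
  assumes f: "integrable M f"
  shows "\<tau> (cls f) = (LINT \<omega>|M. f \<omega>)"
proof -
  have "(LINT \<omega>|M. rep (cls f) \<omega>) = (LINT \<omega>|M. f \<omega>)"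
    using rep_cls[OF f] f by (intro integral_cong_AE) auto
  with f show ?thesis by (auto simp: \<tau>_def vset_L)
qed

lemma \<tau>_dual: "\<tau> \<in> vset (dual (L :: ('k::{real_normed_field, euclidean_space}, ('a \<Rightarrow> 'k) set) nspace))"
proof -
  have "norm (\<tau> x) \<le> (1 / sqrt (a 0)) * vnorm L x" if "x \<in> vset L" for x :: "('a \<Rightarrow> 'k) set"
  proof -
    from that obtain f where f: "integrable M f" and x: "x = cls f" by (auto simp: vset_L)
    have "sqrt (a 0) * norm (LINT \<omega>|M. f \<omega>) \<le> sqrt (a 0) * (LINT \<omega>|M. norm (f \<omega>))"
      by (intro mult_left_mono integral_norm_bound) simp
    also have "\<dots> \<le> square_norm M T a f" by (rule square_norm_ge[OF f])
    finally show ?thesis using a[of 0] f by (simp add: x \<tau>_cls vnorm_L field_simps)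
  qed
  moreover have "\<tau> x = 0" if "x \<notin> vset L" for x :: "('a \<Rightarrow> 'k) set" using that by (simp add: \<tau>_def)
  moreover have "\<tau> (vadd L x y) = \<tau> x + \<tau> y" "\<tau> (vscale L c x) = c * \<tau> x"
    if "x \<in> vset L" "y \<in> vset L" for c and x y :: "('a \<Rightarrow> 'k) set"
    using that by (auto simp: vset_L vadd_L vscale_L \<tau>_cls)
  ultimately show ?thesis unfolding vset_dual by blast
qed

definition unit_mass :: "'a set \<Rightarrow> ('a \<Rightarrow> 'k::{real_normed_field, euclidean_space}) set" where
  "unit_mass A = cls (\<lambda>\<omega>. indicat_real A \<omega> *\<^sub>R of_real (1 / measure M A))"

lemma unit_mass:
  assumes A: "A \<in> sets M" and pos: "measure M A > 0"
  shows "unit_mass A \<in> vset (L :: ('k::{real_normed_field, euclidean_space}, ('a \<Rightarrow> 'k) set) nspace)"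
    and "vnorm L (unit_mass A :: ('a \<Rightarrow> 'k) set) \<le> S"
    and "\<tau> (unit_mass A) = (1 :: 'k)"
    and "\<And>B. B \<in> sets M \<Longrightarrow> A \<subseteq> B \<Longrightarrow> band B (unit_mass A) = (unit_mass A :: ('a \<Rightarrow> 'k) set)"
proof -
  let ?u = "\<lambda>\<omega>. indicat_real A \<omega> *\<^sub>R (of_real (1 / measure M A) :: 'k)"
  have u: "integrable M ?u" using A by (intro integrable_mult_indicator) auto
  have "square_norm M T a ?u \<le> S * (LINT \<omega>|M. norm (?u \<omega>))" by (rule square_norm_le[OF u])
  also have "(LINT \<omega>|M. norm (?u \<omega>)) = (LINT \<omega>|M. indicat_real A \<omega> * (1 / measure M A))"
    using pos by (intro Bochner_Integration.integral_cong) (auto split: split_indicator simp: norm_divide)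
  also have "\<dots> = 1" using A pos by simp
  finally show "vnorm L (unit_mass A :: ('a \<Rightarrow> 'k) set) \<le> S" using u by (simp add: unit_mass_def vnorm_L)
  show "unit_mass A \<in> vset (L :: ('k, ('a \<Rightarrow> 'k) set) nspace)"
    using u by (auto simp: unit_mass_def vset_L)
  have "(LINT \<omega>|M. ?u \<omega>) = measure M A *\<^sub>R of_real (1 / measure M A)"
    using A by (subst integral_scaleR_left) (auto simp: emeasure_eq_measure)
  then have "(LINT \<omega>|M. ?u \<omega>) = 1" using pos by (simp add: scaleR_conv_of_real flip: of_real_mult)
  then show "\<tau> (unit_mass A) = (1 :: 'k)" unfolding unit_mass_def using \<tau>_cls[OF u] by simp
  show "band B (unit_mass A) = (unit_mass A :: ('a \<Rightarrow> 'k) set)" if "B \<in> sets M" "A \<subseteq> B" for B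
    unfolding unit_mass_def band_cls[OF that(1) u] using that(2)
    by (intro arg_cong[of _ _ cls] ext) (auto split: split_indicator)
qed

text \<open>
  The bounded density \<open>g\<close> of \<open>\<phi>\<close> has a limit \<open>c\<close> along the ultrafilter. On the member
  \<open>B\<close> of \<open>U\<close> where \<open>g\<close> is within \<open>\<delta>\<close> of \<open>c\<close>, the functionals \<open>\<phi>\<close> and \<open>c\<close> times \<open>\<tau>\<close> differ by at most \<open>\<delta>\<close>
  times the \<open>L\<^sub>1\<close>-norm, which the new norm controls up to the factor \<open>sqrt (a 0)\<close>.
\<close>

lemma functional_concentrates:
  fixes \<phi> :: "('a \<Rightarrow> 'k::{real_normed_field, euclidean_space}) set \<Rightarrow> 'k"
  assumes U: "ultra U" "U \<le> ae_filter M" and \<phi>: "\<phi> \<in> vset (dual L)"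
  shows "\<exists>c. \<forall>\<epsilon>>0. \<exists>B\<in>sets M. eventually (\<lambda>\<omega>. \<omega> \<in> B) U \<and>
    (\<forall>A\<in>sets M. A \<subseteq> B \<longrightarrow> (\<forall>x\<in>vset L. norm (\<phi> (band A x) - c * \<tau> (band A x)) \<le> \<epsilon> * vnorm L x))"
proof -
  have S: "0 \<le> S" by (intro infsum_nonneg) simp
  have N: "0 \<le> vnorm (dual L) \<phi>" by (rule dual_norm_nonneg[OF homogeneous_L \<phi>])
  have "\<exists>g\<in>borel_measurable M. (\<forall>\<omega>. norm (g \<omega>) \<le> vnorm (dual L) \<phi> * S) \<and>
    (\<forall>f. integrable M f \<longrightarrow> \<phi> (cls f) = (LINT \<omega>|M. g \<omega> * f \<omega>))"
  proof (rule bounded_functional_density)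
    fix f g :: "'a \<Rightarrow> 'k" assume f: "integrable M f"
    show "\<phi> (cls (\<lambda>x. c * f x)) = c * \<phi> (cls f)" for c
      using dual_apply(2)[OF \<phi>, of "cls f" c] f by (auto simp: vset_L vscale_L)
    have "norm (\<phi> (cls f)) \<le> vnorm (dual L) \<phi> * square_norm M T a f"
      using dual_bound[OF homogeneous_L \<phi>, of "cls f"] f by (auto simp: vset_L vnorm_L)
    also have "\<dots> \<le> vnorm (dual L) \<phi> * (S * (LINT x|M. norm (f x)))"
      by (intro mult_left_mono square_norm_le f N)
    finally show "norm (\<phi> (cls f)) \<le> vnorm (dual L) \<phi> * S * (LINT x|M. norm (f x))"
      by (simp add: mult.assoc)
    assume g: "integrable M g"
    show "\<phi> (cls (\<lambda>x. f x + g x)) = \<phi> (cls f) + \<phi> (cls g)"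
      using dual_apply(1)[OF \<phi>, of "cls f" "cls g"] f g by (auto simp: vset_L vadd_L)
  qed (simp add: N S)
  then obtain g where [measurable]: "g \<in> borel_measurable M"
    and g_bound: "\<And>\<omega>. norm (g \<omega>) \<le> vnorm (dual L) \<phi> * S"
    and g: "\<And>f. integrable M f \<Longrightarrow> \<phi> (cls f) = (LINT \<omega>|M. g \<omega> * f \<omega>)" by blast
  obtain c where c: "(g \<longlongrightarrow> c) U"
  proof (rule ultra_tendsto[OF U(1) _ bounded_cball])
    show "eventually (\<lambda>\<omega>. g \<omega> \<in> cball 0 (vnorm (dual L) \<phi> * S)) U"
      using g_bound by (intro always_eventually) simp
  qed
  show ?thesis
  proof (intro exI[of _ c] allI impI)
    fix \<epsilon> :: real assume \<epsilon>: "0 < \<epsilon>"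
    define \<delta> where "\<delta> = \<epsilon> * sqrt (a 0)"
    have \<delta>: "\<delta> > 0" using \<epsilon> a[of 0] by (simp add: \<delta>_def)
    define B where "B = {\<omega> \<in> space M. norm (g \<omega> - c) < \<delta>}"
    have B: "B \<in> sets M" unfolding B_def by measurable
    have BU: "eventually (\<lambda>\<omega>. \<omega> \<in> B) U"
      using tendstoD[OF c \<delta>] filter_leD[OF U(2) AE_space]
      by eventually_elim (simp add: B_def dist_norm)
    have "norm (\<phi> (band A (cls f)) - c * \<tau> (band A (cls f))) \<le> \<epsilon> * vnorm L (cls f)"
      if A: "A \<in> sets M" "A \<subseteq> B" and f: "integrable M f" for A f
    proof -
      let ?f = "\<lambda>\<omega>. indicat_real A \<omega> *\<^sub>R f \<omega>"
      have fA: "integrable M ?f" by (rule integrable_mult_indicator[OF A(1) f])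
      have gf: "integrable M (\<lambda>\<omega>. g \<omega> * ?f \<omega>)"
      proof (rule Bochner_Integration.integrable_bound)
        show "integrable M (\<lambda>\<omega>. vnorm (dual L) \<phi> * S * norm (?f \<omega>))"
          using fA by (intro integrable_mult_right integrable_norm)
        show "(\<lambda>\<omega>. g \<omega> * ?f \<omega>) \<in> borel_measurable M"
          using borel_measurable_integrable[OF fA] by measurable
        show "AE \<omega> in M. norm (g \<omega> * ?f \<omega>) \<le> norm (vnorm (dual L) \<phi> * S * norm (?f \<omega>))"
          unfolding norm_mult[of "g _"] real_norm_def
          by (intro AE_I2 order_trans[OF mult_right_mono[OF g_bound norm_ge_zero] abs_ge_self])
      qed
      have "\<phi> (band A (cls f)) - c * \<tau> (band A (cls f)) = (LINT \<omega>|M. g \<omega> * ?f \<omega>) - (LINT \<omega>|M. c * ?f \<omega>)"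
        by (simp add: band_cls[OF A(1) f] g[OF fA] \<tau>_cls[OF fA] del: mult_scaleR_right)
      also have "\<dots> = (LINT \<omega>|M. g \<omega> * ?f \<omega> - c * ?f \<omega>)"
        by (rule Bochner_Integration.integral_diff[OF gf integrable_mult_right[OF fA], symmetric])
      also have "norm \<dots> \<le> (LINT \<omega>|M. norm (g \<omega> * ?f \<omega> - c * ?f \<omega>))"
        by (rule integral_norm_bound)
      also have "\<dots> \<le> (LINT \<omega>|M. \<delta> * norm (f \<omega>))"
      proof (rule integral_mono)
        show "integrable M (\<lambda>\<omega>. norm (g \<omega> * ?f \<omega> - c * ?f \<omega>))"
          by (rule integrable_norm[OF Bochner_Integration.integrable_diff[OF gf integrable_mult_right[OF fA]]])
        show "integrable M (\<lambda>\<omega>. \<delta> * norm (f \<omega>))" using f by simp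
        fix \<omega>
        show "norm (g \<omega> * ?f \<omega> - c * ?f \<omega>) \<le> \<delta> * norm (f \<omega>)"
        proof (cases "\<omega> \<in> A")
          case True
          then have "norm (g \<omega> - c) \<le> \<delta>" using A(2) by (auto simp: B_def)
          then have "norm ((g \<omega> - c) * f \<omega>) \<le> \<delta> * norm (f \<omega>)"
            by (simp only: norm_mult mult_right_mono norm_ge_zero)
          with True show ?thesis by (simp add: left_diff_distrib)
        qed (use \<delta> in simp)
      qed
      also have "\<dots> = \<epsilon> * (sqrt (a 0) * (LINT \<omega>|M. norm (f \<omega>)))" by (simp add: \<delta>_def)
      also have "\<dots> \<le> \<epsilon> * square_norm M T a f"
        using \<epsilon> by (intro mult_left_mono square_norm_ge f) auto
      finally show ?thesis by (simp add: vnorm_L[OF f])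
    qed
    with B BU show "\<exists>B\<in>sets M. eventually (\<lambda>\<omega>. \<omega> \<in> B) U \<and>
      (\<forall>A\<in>sets M. A \<subseteq> B \<longrightarrow> (\<forall>x\<in>vset L. norm (\<phi> (band A x) - c * \<tau> (band A x)) \<le> \<epsilon> * vnorm L x))"
      by (intro bexI[of _ B]) (auto simp: vset_L)
  qed
qed

theorem bidual_L_not_daugavet:
  "\<not> daugavet_property (bidual (L :: ('k::{real_normed_field, euclidean_space}, ('a \<Rightarrow> 'k) set) nspace))"
proof -
  have "ae_filter M \<noteq> bot" by (simp add: trivial_limit_def AE_False)
  then obtain U where U: "U \<le> ae_filter M" "ultra U" by (rule ultra_below)
  obtain W where W: "ultra W"
    "eventually (\<lambda>A. A \<in> sets M \<and> eventually (\<lambda>x. x \<in> A) U) W"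
    "\<And>B. B \<in> sets M \<Longrightarrow> eventually (\<lambda>x. x \<in> B) U \<Longrightarrow> eventually (\<lambda>A. A \<subseteq> B) W"
    using shrinking_sets[OF U(2,1)] by blast
  define I where "I = {A \<in> sets M. eventually (\<lambda>x. x \<in> A) U}"
  have I: "A \<in> sets M" "measure M A > 0" if "A \<in> I" for A
  proof -
    show A: "A \<in> sets M" using that by (simp add: I_def)
    \<comment> \<open>\<open>U\<close> refines the almost-everywhere filter, so it contains no null set\<close>
    have "measure M A \<noteq> 0"
    proof
      assume "measure M A = 0"
      with A have "AE x in M. x \<notin> A"
        by (intro AE_not_in) (simp add: null_sets_def emeasure_eq_measure)
      then have "eventually (\<lambda>x. x \<notin> A) U" by (rule filter_leD[OF U(1)])
      moreover have "eventually (\<lambda>x. x \<in> A) U" using that by (simp add: I_def)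
      ultimately have "eventually (\<lambda>x. False) U" by eventually_elim simp
      with U(2) show False by (simp add: ultra_def trivial_limit_def)
    qed
    then show "measure M A > 0" by (simp add: zero_less_measure_iff)
  qed
  have WI: "eventually (\<lambda>A. A \<in> I) W" using W(2) by (simp add: I_def)
  interpret shrinking_bands "L :: ('k, ('a \<Rightarrow> 'k) set) nspace" W I band "\<lambda>A. band (space M - A)"
    unit_mass \<tau> S
  proof
    show "homogeneous (L :: ('k, ('a \<Rightarrow> 'k) set) nspace)" by (rule homogeneous_L)
    show "vadd L x y \<in> vset L" if "x \<in> vset L" "y \<in> vset L" for x y :: "('a \<Rightarrow> 'k) set"
      using that by (auto simp: vset_L vadd_L)
    show "ultra W" "eventually (\<lambda>A. A \<in> I) W" by (fact W(1) WI)+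
    show "\<tau> \<in> vset (dual (L :: ('k, ('a \<Rightarrow> 'k) set) nspace))" by (rule \<tau>_dual)
    fix A assume A: "A \<in> I"
    show "contraction (L :: ('k, ('a \<Rightarrow> 'k) set) nspace) (band A)"
      "contraction (L :: ('k, ('a \<Rightarrow> 'k) set) nspace) (band (space M - A))"
      using I(1)[OF A] by (auto intro: contraction_band)
    show "unit_mass A \<in> vset (L :: ('k, ('a \<Rightarrow> 'k) set) nspace) \<and> vnorm L (unit_mass A :: ('a \<Rightarrow> 'k) set) \<le> S"
      using unit_mass(1,2)[OF I[OF A]] by blast
    show "band A (unit_mass A) = (unit_mass A :: ('a \<Rightarrow> 'k) set)" "\<tau> (unit_mass A) = (1 :: 'k)"
      using unit_mass(3,4)[OF I[OF A]] I(1)[OF A] by auto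
    show "eventually (\<lambda>B. band A (unit_mass B) = (unit_mass B :: ('a \<Rightarrow> 'k) set)) W"
    proof -
      have "eventually (\<lambda>B. B \<subseteq> A) W" using A by (intro W(3)) (auto simp: I_def)
      with WI show ?thesis by eventually_elim (rule unit_mass(4)[OF I I(1)[OF A]])
    qed
    show "vadd L (band A x) (band (space M - A) x) = x" if "x \<in> vset L" for x :: "('a \<Rightarrow> 'k) set"
    proof -
      from that obtain f where f: "integrable M f" and x: "x = cls f" by (auto simp: vset_L)
      have "space M - A \<in> sets M" using I(1)[OF A] by auto
      note s = I(1)[OF A] this
      have "cls (\<lambda>\<omega>. indicat_real A \<omega> *\<^sub>R f \<omega> + indicat_real (space M - A) \<omega> *\<^sub>R f \<omega>) = cls f"
        using s f by (intro cls_eqI AE_I2) (auto intro!: integrable_mult_indicator split: split_indicator)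
      with s f show ?thesis
        by (simp add: x band_cls vadd_L integrable_mult_indicator)
    qed
  next
    fix \<phi> :: "('a \<Rightarrow> 'k) set \<Rightarrow> 'k" assume \<phi>: "\<phi> \<in> vset (dual L)"
    obtain c where c: "\<forall>\<epsilon>>0. \<exists>B\<in>sets M. eventually (\<lambda>\<omega>. \<omega> \<in> B) U \<and>
      (\<forall>A\<in>sets M. A \<subseteq> B \<longrightarrow> (\<forall>x\<in>vset L. norm (\<phi> (band A x) - c * \<tau> (band A x)) \<le> \<epsilon> * vnorm L x))"
      using functional_concentrates[OF U(2,1) \<phi>] by (elim exE)
    have "eventually (\<lambda>A. \<forall>x\<in>vset L. norm (\<phi> (band A x) - c * \<tau> (band A x)) \<le> \<epsilon> * vnorm L x) W"
      if \<epsilon>: "0 < \<epsilon>" for \<epsilon>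
    proof -
      obtain B where B: "B \<in> sets M" "eventually (\<lambda>\<omega>. \<omega> \<in> B) U"
        "\<And>A. A \<in> sets M \<Longrightarrow> A \<subseteq> B \<Longrightarrow>
          \<forall>x\<in>vset L. norm (\<phi> (band A x) - c * \<tau> (band A x)) \<le> \<epsilon> * vnorm L x"
        using c[rule_format, OF \<epsilon>] by blast
      from W(3)[OF B(1,2)] WI show ?thesis
        by eventually_elim (rule B(3)[OF I(1)])
    qed
    then show "\<exists>c. \<forall>\<epsilon>>0. eventually (\<lambda>A. \<forall>x\<in>vset L.
        norm (\<phi> (band A x) - c * \<tau> (band A x)) \<le> \<epsilon> * vnorm L x) W" by blast
  qed
  show ?thesis by (rule bidual_not_daugavet)
qed

end

theorem fact3p15:
  fixes M :: "'a measure" and T :: "'a \<Rightarrow> 'a" and a :: "int \<Rightarrow> real"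
  assumes "prob_space M"
    and "atomless M"
    and "invertible_mpt M T"
    and "\<And>k. a k > 0"
    and "(a has_sum 1) UNIV"
    and "(\<lambda>k. sqrt (a k)) summable_on UNIV"
  shows "\<not> daugavet_property (bidual (renormed_L1 M T a :: (real, ('a \<Rightarrow> real) set) nspace)) \<and>
         \<not> daugavet_property (bidual (renormed_L1 M T a :: (complex, ('a \<Rightarrow> complex) set) nspace))"
proof -
  interpret prob_space M by fact
  interpret orbit_norm M T a by unfold_locales (rule assms)+
  show ?thesis by (intro conjI bidual_L_not_daugavet)
qed

end
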